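(* Let $Y$ be a locally compact Hausdorff space. Suppose that $E$ is a closed subspace of $C_0(Y,\mathbb{R})$ which separates the points of $Y$, and that $E$ satisfies the condition $(r)$. Then $E$ satisfies the Mazur-Ulam property. In particular, $C_0(Y,\mathbb{R})$ satisfies the Mazur-Ulam property.
   Context: $C_0(Y,\mathbb{R})$ is the real Banach space (supremum norm) of all real-valued continuous functions on $Y$ which vanish at infinity. A subspace $E$ separates the points of $Y$ if for any two different points $y_1,y_2\in Y$ there is $e\in E$ with $e(y_1)\ne e(y_2)$. The Choquet boundary $\mathrm{Ch}(E)$ is the set of all $y\in Y$ such that the point evaluation $\delta_y:E\to\mathbb{R}$, $\delta_y(f)=f(y)$, is an extreme point of the closed unit ball of $E^*$. The condition $(r)$: for any $y\in\mathrm{Ch}(E)$, any neighborhood $V$ of $y$, and any $\varepsilon>0$, there exists $u\in E$ such that $0\le u\le 1$ on $Y$, $u(y)=1$, and $0\le u\le\varepsilon$ on $Y\setminus V$. For a real Banach space $B$, $S(B)=\{a\in B:\|a\|=1\}$ with the norm metric. A real Banach space $E$ satisfies the Mazur-Ulam property if every surjective isometry (no linearity assumed) from $S(E)$ onto the unit sphere $S(B)$ of any real Banach space $B$ extends to a surjective real-linear isometry from $E$ onto $B$. *)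

theory Defs
  imports "HOL-Analysis.Analysis" "HOL-Library.Function_Algebras"
begin

section \<open>Functions vanishing at infinity\<close>

text \<open>The norm of \<^typ>\<open>'a \<Rightarrow>\<^sub>C real\<close> is the supremum norm.\<close>

definition C0 :: "('a::topological_space \<Rightarrow>\<^sub>C real) set" where
  "C0 = {f. \<forall>e>0. compact {y. e \<le> \<bar>apply_bcontfun f y\<bar>}}"

lemma closed_superlevel: "closed {y. (e::real) \<le> \<bar>apply_bcontfun f y\<bar>}"
  by (intro closed_Collect_le continuous_intros) auto

lemma C0_I:
  assumes "\<And>e. e > 0 \<Longrightarrow> \<exists>K. compact K \<and> (\<forall>y. y \<notin> K \<longrightarrow> \<bar>apply_bcontfun f y\<bar> < e)"
  shows "f \<in> C0"
  unfolding C0_def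
proof (intro CollectI allI impI)
  fix e :: real assume "e > 0"
  then obtain K where K: "compact K" "\<forall>y. y \<notin> K \<longrightarrow> \<bar>apply_bcontfun f y\<bar> < e"
    using assms by blast
  then have "{y. e \<le> \<bar>apply_bcontfun f y\<bar>} = K \<inter> {y. e \<le> \<bar>apply_bcontfun f y\<bar>}"
    by force
  then show "compact {y. e \<le> \<bar>apply_bcontfun f y\<bar>}"
    using compact_Int_closed[OF K(1) closed_superlevel] by metis
qed

lemma C0_D:
  assumes "f \<in> C0" "e > 0"
  obtains K where "compact K" "\<And>y. y \<notin> K \<Longrightarrow> \<bar>apply_bcontfun f y\<bar> < e"
  using assms unfolding C0_def by (metis (mono_tags, lifting) mem_Collect_eq not_le)

lemma subspace_C0: "subspace C0"
  unfolding subspace_def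
proof (intro conjI ballI allI)
  show "0 \<in> C0" by (rule C0_I) auto
next
  fix f g :: "'a \<Rightarrow>\<^sub>C real" assume f: "f \<in> C0" and g: "g \<in> C0"
  show "f + g \<in> C0"
  proof (rule C0_I)
    fix e :: real assume "e > 0"
    then obtain K L where "compact K" "compact L"
      and K: "\<And>y. y \<notin> K \<Longrightarrow> \<bar>apply_bcontfun f y\<bar> < e / 2"
      and L: "\<And>y. y \<notin> L \<Longrightarrow> \<bar>apply_bcontfun g y\<bar> < e / 2"
      using C0_D[OF f, of "e / 2"] C0_D[OF g, of "e / 2"] by (metis half_gt_zero)
    moreover have "\<bar>apply_bcontfun (f + g) y\<bar> < e" if "y \<notin> K \<union> L" for y
      using K[of y] L[of y] that by (simp add: plus_bcontfun.rep_eq)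
    ultimately show "\<exists>K. compact K \<and> (\<forall>y. y \<notin> K \<longrightarrow> \<bar>apply_bcontfun (f + g) y\<bar> < e)"
      using compact_Un by blast
  qed
next
  fix c :: real and f :: "'a \<Rightarrow>\<^sub>C real" assume f: "f \<in> C0"
  show "c *\<^sub>R f \<in> C0"
  proof (rule C0_I)
    fix e :: real assume e: "e > 0"
    have pos: "e / (\<bar>c\<bar> + 1) > 0"
      using e by simp
    obtain K where "compact K"
      and K: "\<And>y. y \<notin> K \<Longrightarrow> \<bar>apply_bcontfun f y\<bar> < e / (\<bar>c\<bar> + 1)"
      using C0_D[OF f pos] by blast
    moreover have "\<bar>apply_bcontfun (c *\<^sub>R f) y\<bar> < e" if "y \<notin> K" for y
    proof -
      have "\<bar>c\<bar> * \<bar>apply_bcontfun f y\<bar> \<le> (\<bar>c\<bar> + 1) * \<bar>apply_bcontfun f y\<bar>"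
        by (simp add: mult_right_mono)
      also have "\<dots> < e"
        using K[OF that] by (simp add: pos_less_divide_eq mult.commute)
      finally show ?thesis
        by (simp add: scaleR_bcontfun.rep_eq abs_mult)
    qed
    ultimately show "\<exists>K. compact K \<and> (\<forall>y. y \<notin> K \<longrightarrow> \<bar>apply_bcontfun (c *\<^sub>R f) y\<bar> < e)"
      by blast
  qed
qed

lemma closed_C0: "closed C0"
  unfolding closure_subset_eq[symmetric]
proof
  fix f :: "'a \<Rightarrow>\<^sub>C real" assume f: "f \<in> closure C0"
  show "f \<in> C0"
  proof (rule C0_I)
    fix e :: real assume "e > 0"
    then obtain g where g: "g \<in> C0" "dist g f < e / 2"
      using f unfolding closure_approachable by (meson half_gt_zero)
    obtain K where "compact K" and K: "\<And>y. y \<notin> K \<Longrightarrow> \<bar>apply_bcontfun g y\<bar> < e / 2"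
      using C0_D[OF g(1), of "e / 2"] \<open>e > 0\<close> by (metis half_gt_zero)
    moreover have "\<bar>apply_bcontfun f y\<bar> < e" if "y \<notin> K" for y
      using K[OF that] dist_bounded[of g y f] g(2) by (auto simp: dist_real_def)
    ultimately show "\<exists>K. compact K \<and> (\<forall>y. y \<notin> K \<longrightarrow> \<bar>apply_bcontfun f y\<bar> < e)"
      by blast
  qed
qed

definition separates_points :: "('a::topological_space \<Rightarrow>\<^sub>C real) set \<Rightarrow> bool" where
  "separates_points E \<longleftrightarrow>
    (\<forall>x y. x \<noteq> y \<longrightarrow> (\<exists>f\<in>E. apply_bcontfun f x \<noteq> apply_bcontfun f y))"


section \<open>The dual of a subspace\<close>

definition linear_on :: "'v::real_vector set \<Rightarrow> ('v \<Rightarrow> 'w::real_vector) \<Rightarrow> bool" where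
  "linear_on E f \<longleftrightarrow>
    (\<forall>x\<in>E. \<forall>y\<in>E. f (x + y) = f x + f y) \<and> (\<forall>c. \<forall>x\<in>E. f (c *\<^sub>R x) = c *\<^sub>R f x)"

text \<open>
  A functional on the subspace \<open>E\<close> is represented by the function on the ambient space that is
  zero outside \<open>E\<close>, so that equality of functions is equality of functionals on \<open>E\<close>.
\<close>

definition dual_space :: "'v::real_normed_vector set \<Rightarrow> ('v \<Rightarrow> real) set" where
  "dual_space E =
    {\<phi>. linear_on E \<phi> \<and> (\<exists>K. \<forall>x\<in>E. \<bar>\<phi> x\<bar> \<le> K * norm x) \<and> (\<forall>x. x \<notin> E \<longrightarrow> \<phi> x = 0)}"

definition dual_norm :: "'v::real_normed_vector set \<Rightarrow> ('v \<Rightarrow> real) \<Rightarrow> real" where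
  "dual_norm E \<phi> = (SUP x \<in> E \<inter> cball 0 1. \<bar>\<phi> x\<bar>)"

definition dual_unit_ball :: "'v::real_normed_vector set \<Rightarrow> ('v \<Rightarrow> real) set" where
  "dual_unit_ball E = {\<phi> \<in> dual_space E. dual_norm E \<phi> \<le> 1}"

text \<open>
  The pointwise real vector space structure, needed for \<^const>\<open>extreme_point_of\<close> to apply to
  sets of functionals.
\<close>

instantiation "fun" :: (type, real_vector) real_vector
begin

definition scaleR_fun_def: "c *\<^sub>R f = (\<lambda>x. c *\<^sub>R f x)"

instance
  by standard (auto simp: fun_eq_iff scaleR_fun_def scaleR_add_right scaleR_add_left)

end


section \<open>Choquet boundary and the condition (r)\<close>

definition point_eval :: "('a::topological_space \<Rightarrow>\<^sub>C real) set \<Rightarrow> 'a \<Rightarrow> ('a \<Rightarrow>\<^sub>C real) \<Rightarrow> real" where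
  "point_eval E y = (\<lambda>f. if f \<in> E then apply_bcontfun f y else 0)"

definition choquet_boundary :: "('a::topological_space \<Rightarrow>\<^sub>C real) set \<Rightarrow> 'a set" where
  "choquet_boundary E = {y. point_eval E y extreme_point_of dual_unit_ball E}"

definition condition_r :: "('a::topological_space \<Rightarrow>\<^sub>C real) set \<Rightarrow> bool" where
  "condition_r E \<longleftrightarrow>
    (\<forall>y \<in> choquet_boundary E. \<forall>V. open V \<and> y \<in> V \<longrightarrow>
      (\<forall>\<epsilon>>0. \<exists>u\<in>E.
        (\<forall>x. 0 \<le> apply_bcontfun u x \<and> apply_bcontfun u x \<le> 1) \<and>
        apply_bcontfun u y = 1 \<and>
        (\<forall>x. x \<notin> V \<longrightarrow> apply_bcontfun u x \<le> \<epsilon>)))"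


section \<open>The Mazur--Ulam property\<close>

definition surj_isometry_on :: "'v::metric_space set \<Rightarrow> 'w::metric_space set \<Rightarrow> ('v \<Rightarrow> 'w) \<Rightarrow> bool" where
  "surj_isometry_on S S' T \<longleftrightarrow> T ` S = S' \<and> (\<forall>x\<in>S. \<forall>y\<in>S. dist (T x) (T y) = dist x y)"

text \<open>
  The property of the Banach space \<open>E\<close> (a complete subspace of a normed space) relative to the
  target Banach spaces that are complete subspaces of the type \<open>'w\<close>; taking \<open>B = UNIV\<close> covers a
  type \<open>'w\<close> of class \<open>banach\<close> itself. A formula of HOL cannot quantify over types, so the target
  type is a parameter: a theorem in which \<open>'w\<close> is a free type variable speaks about all
  real Banach spaces.
\<close>

definition mazur_ulam_property ::
    "'w::real_normed_vector itself \<Rightarrow> 'v::real_normed_vector set \<Rightarrow> bool" where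
  "mazur_ulam_property W E \<longleftrightarrow>
    (\<forall>(B :: 'w set) T. subspace B \<and> complete B \<and>
        surj_isometry_on (E \<inter> sphere 0 1) (B \<inter> sphere 0 1) T \<longrightarrow>
      (\<exists>L. linear_on E L \<and> surj_isometry_on E B L \<and> (\<forall>x \<in> E \<inter> sphere 0 1. L x = T x)))"

end

theory Submission
  imports Defs
begin

text \<open>
  Let \<open>T\<close> be a surjective isometry of \<open>S(E)\<close> onto \<open>S(B)\<close>. For a point \<open>y\<close> of the Choquet boundary the
  faces \<open>P = {u. u(y) = 1}\<close> and \<open>-P\<close> of \<open>S(E)\<close> have images whose convex hulls lie in \<open>S(B)\<close>, and
  \<open>T(-P) \<subseteq> -T(P)\<close>, because \<open>P\<close> consists of the points at distance 2 from all of \<open>-P\<close>. So there is a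
  sublinear \<open>p \<le> \<parallel>\<cdot>\<parallel>\<close> equal to 1 on \<open>T(P)\<close> and to \<open>-1\<close> on \<open>T(-P)\<close>. Condition \<open>(r)\<close> makes the distance of
  \<open>f\<close> to \<open>\<plusminus>P\<close> equal to \<open>1 \<mp> f(y)\<close>, which forces \<open>p(T f) = f(y)\<close>; hence \<open>p\<close> is odd, and so linear, on
  \<open>B\<close>. Every \<open>f \<in> S(E)\<close> has \<open>\<bar>f(y)\<bar> = 1\<close> at some \<open>y\<close> of the Choquet boundary, so these functionals
  separate the points of \<open>B\<close> and the homogeneous extension of \<open>T\<close> is linear.
\<close>

section \<open>Norm attainment at the Choquet boundary\<close>

text \<open>Outside the compact set where \<open>\<bar>f\<bar>\<close> is at least half the norm no
  value can compete, so the maximum over that set is global.\<close>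

lemma C0_norm_attained:
  assumes f: "f \<in> C0" and "f \<noteq> 0"
  obtains y where "\<bar>apply_bcontfun f y\<bar> = norm f"
proof -
  have pos: "norm f > 0" using \<open>f \<noteq> 0\<close> by simp
  define K where "K = {y. norm f / 2 \<le> \<bar>apply_bcontfun f y\<bar>}"
  have "compact K" using f pos half_gt_zero unfolding C0_def K_def by blast
  have "K \<noteq> {}"
  proof
    assume "K = {}"
    then have "\<bar>apply_bcontfun f x\<bar> \<le> norm f / 2" for x
      unfolding K_def by (force simp: not_le intro: less_imp_le)
    then have "norm f \<le> norm f / 2" by (intro norm_bound) simp
    then show False using pos by simp
  qed
  have "continuous_on K (\<lambda>y. \<bar>apply_bcontfun f y\<bar>)"
    by (intro continuous_intros) auto
  then obtain y where y: "y \<in> K" "\<And>z. z \<in> K \<Longrightarrow> \<bar>apply_bcontfun f z\<bar> \<le> \<bar>apply_bcontfun f y\<bar>"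
    using continuous_attains_sup[OF \<open>compact K\<close> \<open>K \<noteq> {}\<close>] by blast
  have "\<bar>apply_bcontfun f z\<bar> \<le> \<bar>apply_bcontfun f y\<bar>" for z
  proof (cases "z \<in> K")
    case False
    then have "\<bar>apply_bcontfun f z\<bar> < norm f / 2" unfolding K_def by simp
    also have "\<dots> \<le> \<bar>apply_bcontfun f y\<bar>" using y(1) unfolding K_def by simp
    finally show ?thesis by simp
  qed (use y in blast)
  then have "norm f \<le> \<bar>apply_bcontfun f y\<bar>" by (intro norm_bound) simp
  moreover have "\<bar>apply_bcontfun f y\<bar> \<le> norm f" using norm_bounded[of f y] by simp
  ultimately show thesis using that by fastforce
qed

text \<open>A maximum over a compact set of a function of the form \<open>a + \<epsilon> b\<close> has, at \<open>\<epsilon> = 0\<close>, the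
  one-sided derivative \<open>max b\<close>, the maximum being over the points at which \<open>a\<close> is maximal.\<close>

lemma compact_perturbed_maximum:
  fixes a b :: "'y::topological_space \<Rightarrow> real"
  assumes K: "compact K" and a: "continuous_on K a" and b: "continuous_on K b"
    and le: "\<And>y. y \<in> K \<Longrightarrow> a y \<le> M" and "\<epsilon>\<^sub>0 > 0"
    and pert: "\<And>\<epsilon>. 0 < \<epsilon> \<Longrightarrow> \<epsilon> \<le> \<epsilon>\<^sub>0 \<Longrightarrow> \<exists>y\<in>K. M + \<epsilon> * c \<le> a y + \<epsilon> * b y"
  shows "\<exists>y\<in>K. a y = M \<and> c \<le> b y"
proof (rule ccontr)
  assume neg: "\<not> ?thesis"
  \<comment> \<open>A point provided by \<open>pert\<close> lies in \<open>G\<close>, since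
    \<open>a\<close> is at most \<open>M\<close> there. If the claim fails, \<open>a\<close> stays
    below \<open>M\<close> on the compact set \<open>G\<close> by the fixed gap
    \<open>M - a y0\<close>, which a small \<open>\<epsilon>\<close> cannot bridge.\<close>
  define G where "G = {y \<in> K. c \<le> b y}"
  have GK: "G \<subseteq> K" unfolding G_def by auto
  have "closedin (top_of_set K) G"
  proof -
    have "G = K \<inter> b -` {c..}" unfolding G_def by auto
    then show ?thesis using continuous_closedin_preimage[OF b, of "{c..}"] by simp
  qed
  then have G: "compact G" using K by (rule closedin_compact[rotated])
  have inG: "y \<in> G" if "y \<in> K" "0 < \<epsilon>" "M + \<epsilon> * c \<le> a y + \<epsilon> * b y" for y \<epsilon>
  proof -
    have "\<epsilon> * c \<le> \<epsilon> * b y" using le[OF that(1)] that(3) by simp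
    then show ?thesis using that unfolding G_def by simp
  qed
  have "G \<noteq> {}" using pert[of \<epsilon>\<^sub>0] inG \<open>\<epsilon>\<^sub>0 > 0\<close> by blast
  obtain y0 where y0: "y0 \<in> G" "\<And>y. y \<in> G \<Longrightarrow> a y \<le> a y0"
    using continuous_attains_sup[OF G \<open>G \<noteq> {}\<close> continuous_on_subset[OF a GK]] by blast
  obtain y1 where y1: "y1 \<in> G" "\<And>y. y \<in> G \<Longrightarrow> b y \<le> b y1"
    using continuous_attains_sup[OF G \<open>G \<noteq> {}\<close> continuous_on_subset[OF b GK]] by blast
  have m: "a y0 < M" using neg y0(1) le[of y0] unfolding G_def by force
  have d: "b y1 - c \<ge> 0" using y1(1) unfolding G_def by simp
  define \<epsilon> where "\<epsilon> = min \<epsilon>\<^sub>0 ((M - a y0) / (2 * (b y1 - c + 1)))"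
  have "\<epsilon> > 0" "\<epsilon> \<le> \<epsilon>\<^sub>0" using m d \<open>\<epsilon>\<^sub>0 > 0\<close> unfolding \<epsilon>_def by auto
  then obtain y where y: "y \<in> K" "M + \<epsilon> * c \<le> a y + \<epsilon> * b y" using pert by blast
  then have "y \<in> G" using inG \<open>\<epsilon> > 0\<close> by blast
  then have "M - a y0 \<le> M - a y" using y0(2) by simp
  also have "\<dots> \<le> \<epsilon> * (b y - c)" using y(2) by (simp add: algebra_simps)
  also have "\<dots> \<le> \<epsilon> * (b y1 - c + 1)" using y1(2)[OF \<open>y \<in> G\<close>] \<open>\<epsilon> > 0\<close> by simp
  also have "\<dots> \<le> (M - a y0) / (2 * (b y1 - c + 1)) * (b y1 - c + 1)"
    using d unfolding \<epsilon>_def by (intro mult_right_mono) auto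
  also have "\<dots> = (M - a y0) / 2" using d by (simp add: field_simps)
  finally show False using m by simp
qed

section \<open>The dual ball and its faces spanned by signed point evaluations\<close>

text \<open>A supremum of reals bounds its elements only once \<open>bdd_above\<close> is known; the
  constant \<open>K\<close> from \<open>dual_space\<close> supplies this, and rescaling turns the
  bound 1 on the unit ball into \<open>norm x\<close>.\<close>

lemma dual_unit_ball_iff:
  assumes E: "subspace E"
  shows "\<phi> \<in> dual_unit_ball E \<longleftrightarrow>
    linear_on E \<phi> \<and> (\<forall>x\<in>E. \<bar>\<phi> x\<bar> \<le> norm x) \<and> (\<forall>x. x \<notin> E \<longrightarrow> \<phi> x = 0)"
    (is "?L \<longleftrightarrow> ?R")
proof
  assume L: ?L
  then obtain K where lin: "linear_on E \<phi>" and K: "\<And>x. x \<in> E \<Longrightarrow> \<bar>\<phi> x\<bar> \<le> K * norm x"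
    and zero: "\<forall>x. x \<notin> E \<longrightarrow> \<phi> x = 0"
    unfolding dual_unit_ball_def dual_space_def by blast
  have bdd: "bdd_above ((\<lambda>x. \<bar>\<phi> x\<bar>) ` (E \<inter> cball 0 1))"
  proof (rule bdd_aboveI2)
    fix x assume x: "x \<in> E \<inter> cball 0 1"
    then have "\<bar>\<phi> x\<bar> \<le> K * norm x" using K by blast
    also have "\<dots> \<le> \<bar>K\<bar> * norm x" by (simp add: mult_right_mono)
    also have "\<dots> \<le> \<bar>K\<bar> * 1" using x by (intro mult_left_mono) auto
    finally show "\<bar>\<phi> x\<bar> \<le> \<bar>K\<bar>" by simp
  qed
  have le1: "\<bar>\<phi> x\<bar> \<le> 1" if "x \<in> E" "norm x \<le> 1" for x
  proof -
    have "\<bar>\<phi> x\<bar> \<le> dual_norm E \<phi>"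
      unfolding dual_norm_def using that by (intro cSUP_upper bdd) auto
    then show ?thesis using L unfolding dual_unit_ball_def by simp
  qed
  have "\<bar>\<phi> x\<bar> \<le> norm x" if x: "x \<in> E" for x
  proof (cases "x = 0")
    case True
    then show ?thesis using K[OF x] by simp
  next
    case False
    have "\<bar>\<phi> ((1 / norm x) *\<^sub>R x)\<bar> \<le> 1"
      using False by (intro le1 subspace_scale[OF E x]) simp
    moreover have "\<phi> ((1 / norm x) *\<^sub>R x) = \<phi> x / norm x"
      using lin x unfolding linear_on_def by simp
    ultimately show ?thesis using False by (simp add: field_simps)
  qed
  then show ?R using lin zero by blast
next
  assume R: ?R
  have "dual_norm E \<phi> \<le> 1" unfolding dual_norm_def
  proof (rule cSUP_least)
    show "E \<inter> cball 0 1 \<noteq> {}" using subspace_0[OF E] by force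
    fix x assume "x \<in> E \<inter> cball 0 1"
    then show "\<bar>\<phi> x\<bar> \<le> 1" using R by fastforce
  qed
  moreover have "\<exists>K. \<forall>x\<in>E. \<bar>\<phi> x\<bar> \<le> K * norm x" using R by (intro exI[of _ 1]) simp
  ultimately show ?L using R unfolding dual_unit_ball_def dual_space_def by blast
qed

lemma point_eval_in_dual_unit_ball:
  assumes "subspace E"
  shows "point_eval E y \<in> dual_unit_ball E"
proof -
  have "\<bar>apply_bcontfun f y\<bar> \<le> norm f" for f :: "'a \<Rightarrow>\<^sub>C real"
    using norm_bounded[of f y] by simp
  then show ?thesis
    unfolding dual_unit_ball_iff[OF assms] linear_on_def point_eval_def
    using subspace_add[OF assms] subspace_scale[OF assms] by auto
qed

lemma dual_unit_ball_uminus: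
  assumes "subspace E" "\<phi> \<in> dual_unit_ball E"
  shows "- \<phi> \<in> dual_unit_ball E"
  using assms(2) unfolding dual_unit_ball_iff[OF assms(1)] linear_on_def by auto

text \<open>With \<open>\<bar>f\<bar> = 1\<close> on the compact set \<open>K\<close>, \<open>dominated E f K \<phi>\<close> says that \<open>\<phi>\<close> lies in the weak-star
  closed convex hull of the functionals \<open>f(y) \<delta>\<^sub>y\<close>, \<open>y \<in> K\<close>, and \<open>facial E f K\<close> that this hull is a
  face of the dual ball.\<close>

definition dominated ::
    "('y::topological_space \<Rightarrow>\<^sub>C real) set \<Rightarrow> ('y \<Rightarrow>\<^sub>C real) \<Rightarrow> 'y set \<Rightarrow> (('y \<Rightarrow>\<^sub>C real) \<Rightarrow> real) \<Rightarrow> bool" where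
  "dominated E f K \<phi> \<longleftrightarrow> (\<forall>g\<in>E. \<exists>y\<in>K. \<phi> g \<le> apply_bcontfun f y * apply_bcontfun g y)"

definition facial :: "('y::topological_space \<Rightarrow>\<^sub>C real) set \<Rightarrow> ('y \<Rightarrow>\<^sub>C real) \<Rightarrow> 'y set \<Rightarrow> bool" where
  "facial E f K \<longleftrightarrow>
    (\<forall>\<phi>\<in>dual_unit_ball E. \<forall>\<psi>\<in>dual_unit_ball E. \<forall>t. 0 < t \<longrightarrow> t < 1 \<longrightarrow>
      dominated E f K ((1 - t) *\<^sub>R \<phi> + t *\<^sub>R \<psi>) \<longrightarrow> dominated E f K \<phi> \<and> dominated E f K \<psi>)"

lemma dominated_mono: "dominated E f K \<phi> \<Longrightarrow> K \<subseteq> L \<Longrightarrow> dominated E f L \<phi>"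
  unfolding dominated_def by blast

text \<open>The deficits below \<open>M\<close> are nonnegative with weighted sum at most 0. Thus a
  supporting hyperplane touching an inner point of a segment contains both ends.\<close>

lemma convex_combination_eq_bound:
  fixes a b t M :: real
  assumes "a \<le> M" "b \<le> M" "0 < t" "t < 1" "M \<le> (1 - t) * a + t * b"
  shows "a = M \<and> b = M"
proof -
  have "(1 - t) * (M - a) + t * (M - b) \<le> 0" using assms(5) by (simp add: algebra_simps)
  moreover have "(1 - t) * (M - a) \<ge> 0" "t * (M - b) \<ge> 0" using assms by auto
  ultimately have "(1 - t) * (M - a) = 0" "t * (M - b) = 0" by linarith+
  then show ?thesis using assms by simp
qed

lemma dual_unit_ballD:
  assumes "subspace E" "\<phi> \<in> dual_unit_ball E" "g \<in> E" "h \<in> E"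
  shows "\<phi> (g + h) = \<phi> g + \<phi> h" "\<phi> (c *\<^sub>R g) = c * \<phi> g" "\<bar>\<phi> g\<bar> \<le> norm g" "\<phi> (- g) = - \<phi> g"
proof -
  have "\<forall>c. \<forall>x\<in>E. \<phi> (c *\<^sub>R x) = c *\<^sub>R \<phi> x"
    using assms(2) unfolding dual_unit_ball_iff[OF assms(1)] linear_on_def by blast
  from this[rule_format, OF assms(3), of "-1"] show "\<phi> (- g) = - \<phi> g" by simp
next
  show "\<phi> (g + h) = \<phi> g + \<phi> h" "\<phi> (c *\<^sub>R g) = c * \<phi> g" "\<bar>\<phi> g\<bar> \<le> norm g"
    using assms(2-4) by (auto simp: dual_unit_ball_iff[OF assms(1)] linear_on_def)
qed

text \<open>Testing domination at \<open>- f\<close> gives a dominated combination the value at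
  least 1 at \<open>f\<close>, so both of its ends have value 1 there. Conversely, a
  \<open>\<phi>\<close> in the dual ball with \<open>\<phi> f = 1\<close> is dominated: compare
  \<open>1 + \<epsilon> * \<phi> g\<close> with the norm of
  \<open>f + \<epsilon> *\<^sub>R g\<close> to first order in \<open>\<epsilon>\<close>.\<close>

lemma facial_peak_set:
  assumes E: "subspace E" and EC: "E \<subseteq> C0" and f: "f \<in> E" "norm f = 1"
  shows "facial E f {y. \<bar>apply_bcontfun f y\<bar> = 1}"
proof -
  define K where "K = {y. \<bar>apply_bcontfun f y\<bar> = 1}"
  have ff: "apply_bcontfun f y * apply_bcontfun f y = 1" if "y \<in> K" for y
  proof -
    have "apply_bcontfun f y = 1 \<or> apply_bcontfun f y = -1" using that unfolding K_def by auto
    then show ?thesis by auto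
  qed
  have fle: "\<bar>apply_bcontfun f y\<bar> \<le> 1" for y using norm_bounded[of f y] f(2) by simp
  have dom: "dominated E f K \<phi>" if \<phi>: "\<phi> \<in> dual_unit_ball E" and one: "\<phi> f = 1" for \<phi>
    unfolding dominated_def
  proof
    fix g assume g: "g \<in> E"
    \<comment> \<open>On \<open>L\<close> the sign \<open>f / \<bar>f\<bar>\<close> is continuous,
      and so is the first-order term of the absolute value of
      \<open>f + \<epsilon> *\<^sub>R g\<close>.\<close>
    define L where "L = {y. 1 / 2 \<le> \<bar>apply_bcontfun f y\<bar>}"
    have L: "compact L" 
    proof -
      have "f \<in> C0" using f(1) EC by blast
      then show ?thesis using half_gt_zero[OF zero_less_one] unfolding C0_def L_def by blast
    qed
    have "\<exists>y\<in>L. \<bar>apply_bcontfun f y\<bar> = 1 \<and>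
        \<phi> g \<le> apply_bcontfun f y * apply_bcontfun g y / \<bar>apply_bcontfun f y\<bar>"
    \<comment> \<open>This range keeps \<open>\<epsilon> * norm g\<close> below 1/4: the norm of the
      perturbed function is then attained inside \<open>L\<close>, and the perturbation is too small
      to change the sign of \<open>f\<close> there.\<close>
    proof (rule compact_perturbed_maximum[OF L, where \<epsilon>\<^sub>0 = "1 / (4 * (norm g + 1))"])
      show "continuous_on L (\<lambda>y. \<bar>apply_bcontfun f y\<bar>)"
        by (intro continuous_intros) auto
      show "continuous_on L (\<lambda>y. apply_bcontfun f y * apply_bcontfun g y / \<bar>apply_bcontfun f y\<bar>)"
        by (intro continuous_intros) (auto simp: L_def)
      have ng: "norm g + 1 > 0" by (simp add: add_nonneg_pos)
      then show "1 / (4 * (norm g + 1)) > 0" by simp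
      fix \<epsilon> :: real assume \<epsilon>: "0 < \<epsilon>" "\<epsilon> \<le> 1 / (4 * (norm g + 1))"
      have "\<epsilon> * (4 * (norm g + 1)) \<le> 1" using \<epsilon>(2) ng by (simp add: field_simps)
      then have small: "\<epsilon> * norm g < 1 / 4" using \<epsilon>(1) by (simp add: algebra_simps)
      have phig: "\<bar>\<phi> g\<bar> \<le> norm g" using dual_unit_ballD[OF E \<phi> g g] by simp
      define h where "h = f + \<epsilon> *\<^sub>R g"
      have hE: "h \<in> E" unfolding h_def using f g by (intro subspace_add[OF E] subspace_scale[OF E])
      have val: "\<phi> h = 1 + \<epsilon> * \<phi> g" unfolding h_def
        using dual_unit_ballD[OF E \<phi>] f g one subspace_scale[OF E g] by simp
      then have hn: "1 + \<epsilon> * \<phi> g \<le> norm h" using dual_unit_ballD(3)[OF E \<phi> hE hE] by simp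
      have ep: "\<bar>\<epsilon> * \<phi> g\<bar> \<le> \<epsilon> * norm g" using phig \<epsilon> by (simp add: abs_mult)
      then have "norm h > 0" using hn small by linarith
      then obtain y where y: "\<bar>apply_bcontfun h y\<bar> = norm h"
        using C0_norm_attained[of h] hE EC by auto
      have hy: "apply_bcontfun h y = apply_bcontfun f y + \<epsilon> * apply_bcontfun g y"
        unfolding h_def by simp
      have gy: "\<bar>\<epsilon> * apply_bcontfun g y\<bar> \<le> \<epsilon> * norm g"
        using norm_bounded[of g y] \<epsilon> by (simp add: abs_mult)
      have half: "\<bar>apply_bcontfun f y\<bar> \<ge> 1 / 2"
        using y hy gy hn ep small by linarith
      then have "apply_bcontfun f y \<noteq> 0" by auto
      have "\<bar>apply_bcontfun h y\<bar> = \<bar>apply_bcontfun f y\<bar> +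
          \<epsilon> * (apply_bcontfun f y * apply_bcontfun g y / \<bar>apply_bcontfun f y\<bar>)"
      proof (cases "apply_bcontfun f y > 0")
        case True
        then show ?thesis using half gy small unfolding hy by simp
      next
        case False
        then have "apply_bcontfun f y < 0" using \<open>apply_bcontfun f y \<noteq> 0\<close> by simp
        then show ?thesis using half gy small unfolding hy by simp
      qed
      then show "\<exists>y\<in>L. 1 + \<epsilon> * \<phi> g \<le> \<bar>apply_bcontfun f y\<bar> +
          \<epsilon> * (apply_bcontfun f y * apply_bcontfun g y / \<bar>apply_bcontfun f y\<bar>)"
        using half y hn unfolding L_def by (intro bexI[of _ y]) auto
    qed (rule fle)
    then show "\<exists>y\<in>K. \<phi> g \<le> apply_bcontfun f y * apply_bcontfun g y"
      unfolding K_def by auto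
  qed
  have "dominated E f K \<phi> \<and> dominated E f K \<psi>"
    if \<phi>: "\<phi> \<in> dual_unit_ball E" and \<psi>: "\<psi> \<in> dual_unit_ball E" and t: "0 < t" "t < 1"
      and d: "dominated E f K ((1 - t) *\<^sub>R \<phi> + t *\<^sub>R \<psi>)" for \<phi> \<psi> t
  proof -
    have mf: "- f \<in> E" using subspace_neg[OF E f(1)] .
    then obtain y where y: "y \<in> K"
      "((1 - t) *\<^sub>R \<phi> + t *\<^sub>R \<psi>) (- f) \<le> apply_bcontfun f y * apply_bcontfun (- f) y"
      using d unfolding dominated_def by blast
    have "1 \<le> (1 - t) * \<phi> f + t * \<psi> f"
      using y(2) ff[OF y(1)] dual_unit_ballD(4)[OF E \<phi> f(1) f(1)] dual_unit_ballD(4)[OF E \<psi> f(1) f(1)]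
      by (simp add: scaleR_fun_def)
    moreover have "\<phi> f \<le> 1" "\<psi> f \<le> 1"
      using dual_unit_ballD(3)[OF E \<phi> f(1) f(1)] dual_unit_ballD(3)[OF E \<psi> f(1) f(1)] f(2) by auto
    ultimately have "\<phi> f = 1 \<and> \<psi> f = 1" using t convex_combination_eq_bound by blast
    then show ?thesis using dom \<phi> \<psi> by blast
  qed
  then show ?thesis unfolding facial_def K_def by blast
qed

text \<open>The argmax corresponds to cutting the hull of \<open>K\<close> by a supporting
  hyperplane, and a face of a face is a face. Hence on a minimal compact facial set every product
  \<open>f h\<close> is constant.\<close>

lemma facial_argmax:
  assumes E: "subspace E" and K: "compact K" "K \<noteq> {}" "facial E f K" and h: "h \<in> E"
  defines "K' \<equiv> {y\<in>K. \<forall>z\<in>K. apply_bcontfun f z * apply_bcontfun h z \<le> apply_bcontfun f y * apply_bcontfun h y}"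
  shows "compact K'" "K' \<noteq> {}" "facial E f K'"
proof -
  let ?p = "\<lambda>g y. apply_bcontfun f y * apply_bcontfun g y"
  have cont: "continuous_on K (?p g)" for g by (intro continuous_intros) auto
  obtain y0 where y0: "y0 \<in> K" "\<And>z. z \<in> K \<Longrightarrow> ?p h z \<le> ?p h y0"
    using continuous_attains_sup[OF K(1,2) cont[of h]] by blast
  define M where "M = ?p h y0"
  have le: "\<And>z. z \<in> K \<Longrightarrow> ?p h z \<le> M" using y0 M_def by simp
  have K'_eq: "K' = {y\<in>K. ?p h y = M}"
    unfolding K'_def using y0 by (auto simp: M_def intro: antisym)
  then show "K' \<noteq> {}" using y0 M_def by blast
  have "K' = K \<inter> ?p h -` {M}" using K'_eq by auto
  then show "compact K'"
    using continuous_closedin_preimage[OF cont[of h], of "{M}"] closedin_compact[OF K(1)] by simp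
  have K'K: "K' \<subseteq> K" unfolding K'_def by blast
  have dom: "dominated E f K' \<phi>"
    if \<phi>: "\<phi> \<in> dual_unit_ball E" and d: "dominated E f K \<phi>" and one: "\<phi> h = M" for \<phi>
    unfolding dominated_def
  proof
    fix g assume g: "g \<in> E"
    have "\<exists>y\<in>K. ?p h y = M \<and> \<phi> g \<le> ?p g y"
    \<comment> \<open>Any positive range for \<open>\<epsilon>\<close> serves, since domination over
      \<open>K\<close> can be tested at every \<open>h + \<epsilon> *\<^sub>R g\<close>.\<close>
    proof (rule compact_perturbed_maximum[OF K(1) cont cont le, where \<epsilon>\<^sub>0 = 1])
      fix \<epsilon> :: real
      have "h + \<epsilon> *\<^sub>R g \<in> E" using h g by (intro subspace_add[OF E] subspace_scale[OF E])
      then obtain y where y: "y \<in> K" "\<phi> (h + \<epsilon> *\<^sub>R g) \<le> ?p (h + \<epsilon> *\<^sub>R g) y"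
        using d unfolding dominated_def by blast
      have "\<phi> (h + \<epsilon> *\<^sub>R g) = M + \<epsilon> * \<phi> g"
        using dual_unit_ballD[OF E \<phi>] h g one subspace_scale[OF E g] by simp
      then show "\<exists>y\<in>K. M + \<epsilon> * \<phi> g \<le> ?p h y + \<epsilon> * ?p g y"
        using y by (intro bexI[of _ y]) (auto simp: algebra_simps)
    qed auto
    then show "\<exists>y\<in>K'. \<phi> g \<le> ?p g y" unfolding K'_eq by blast
  qed
  have "dominated E f K' \<phi> \<and> dominated E f K' \<psi>"
    if \<phi>: "\<phi> \<in> dual_unit_ball E" and \<psi>: "\<psi> \<in> dual_unit_ball E" and t: "0 < t" "t < 1"
      and d: "dominated E f K' ((1 - t) *\<^sub>R \<phi> + t *\<^sub>R \<psi>)" for \<phi> \<psi> t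
  proof -
    have dK: "dominated E f K \<phi>" "dominated E f K \<psi>"
      using K(3) \<phi> \<psi> t dominated_mono[OF d K'K] unfolding facial_def by blast+
    have "- h \<in> E" using subspace_neg[OF E h] .
    then obtain y where y: "y \<in> K'" "((1 - t) *\<^sub>R \<phi> + t *\<^sub>R \<psi>) (- h) \<le> ?p (- h) y"
      using d unfolding dominated_def by blast
    have "M \<le> (1 - t) * \<phi> h + t * \<psi> h"
      using y dual_unit_ballD(4)[OF E \<phi> h h] dual_unit_ballD(4)[OF E \<psi> h h]
      by (simp add: scaleR_fun_def K'_eq)
    moreover have "\<phi> h \<le> M" "\<psi> h \<le> M"
      using dK h le unfolding dominated_def by (meson order_trans)+
    ultimately have "\<phi> h = M \<and> \<psi> h = M" using t convex_combination_eq_bound by blast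
    then show ?thesis using dom \<phi> \<psi> dK by blast
  qed
  then show "facial E f K'" unfolding facial_def by blast
qed

section \<open>Minimal compact facial sets and extreme evaluations\<close>

text \<open>A finite subfamily of a chain has a least member, which gives the finite intersection
  property; compact sets are closed in a Hausdorff space.\<close>

lemma compact_chain_Inter_nonempty:
  fixes C :: "'y::t2_space set set"
  assumes "C \<noteq> {}" and cpt: "\<And>K. K \<in> C \<Longrightarrow> compact K \<and> K \<noteq> {}"
    and chain: "\<And>K L. K \<in> C \<Longrightarrow> L \<in> C \<Longrightarrow> K \<subseteq> L \<or> L \<subseteq> K"
  shows "\<Inter>C \<noteq> {}"
proof -
  obtain K0 where K0: "K0 \<in> C" using assms(1) by blast
  have min: "\<exists>K\<in>F. \<forall>L\<in>F. K \<subseteq> L" if "finite F" "F \<noteq> {}" "F \<subseteq> C" for F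
    using that
  proof (induction F rule: finite_ne_induct)
    case (insert A F)
    then obtain K where K: "K \<in> F" "\<forall>L\<in>F. K \<subseteq> L" by blast
    have "K \<subseteq> A \<or> A \<subseteq> K" using chain insert.prems K(1) by blast
    then show ?case using K by blast
  qed auto
  have "K0 \<inter> \<Inter>C \<noteq> {}"
  proof (rule compact_imp_fip)
    show "compact K0" using cpt K0 by blast
    show "closed K" if "K \<in> C" for K using cpt[OF that] compact_imp_closed by blast
    fix F assume F: "finite F" "F \<subseteq> C"
    then obtain K where K: "K \<in> insert K0 F" "\<forall>L\<in>insert K0 F. K \<subseteq> L"
      using min[of "insert K0 F"] K0 by auto
    then have "K \<noteq> {}" using cpt F(2) K0 by (metis insert_iff subsetD)
    moreover have "K \<subseteq> K0 \<inter> \<Inter>F" using K(2) by blast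
    ultimately show "K0 \<inter> \<Inter>F \<noteq> {}" by blast
  qed
  then show ?thesis by blast
qed

text \<open>This provides the bounds for Zorn's lemma. For fixed \<open>g\<close> the points of
  \<open>K\<close> that witness domination form a nonempty compact set; over the chain these sets
  are again a chain and so have a common point.\<close>

lemma facial_Inter:
  fixes C :: "'y::t2_space set set"
  assumes "C \<noteq> {}" and cpt: "\<And>K. K \<in> C \<Longrightarrow> compact K" and fac: "\<And>K. K \<in> C \<Longrightarrow> facial E f K"
    and chain: "\<And>K L. K \<in> C \<Longrightarrow> L \<in> C \<Longrightarrow> K \<subseteq> L \<or> L \<subseteq> K"
  shows "facial E f (\<Inter>C)"
proof -
  have dom: "dominated E f (\<Inter>C) \<phi>" if d: "\<And>K. K \<in> C \<Longrightarrow> dominated E f K \<phi>" for \<phi>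
    unfolding dominated_def
  proof
    fix g assume g: "g \<in> E"
    define P where "P = {y. \<phi> g \<le> apply_bcontfun f y * apply_bcontfun g y}"
    have P: "closed P" unfolding P_def by (intro closed_Collect_le continuous_intros) auto
    have "\<Inter>((\<lambda>K. K \<inter> P) ` C) \<noteq> {}"
    proof (rule compact_chain_Inter_nonempty)
      show "compact L \<and> L \<noteq> {}" if "L \<in> (\<lambda>K. K \<inter> P) ` C" for L
        using that cpt P d g unfolding P_def dominated_def by (fastforce intro: compact_Int_closed)
      show "K \<subseteq> L \<or> L \<subseteq> K" if "K \<in> (\<lambda>K. K \<inter> P) ` C" "L \<in> (\<lambda>K. K \<inter> P) ` C" for K L
        using that chain by blast
    qed (use assms(1) in blast)
    then show "\<exists>y\<in>\<Inter>C. \<phi> g \<le> apply_bcontfun f y * apply_bcontfun g y"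
      using assms(1) unfolding P_def by blast
  qed
  have "dominated E f (\<Inter>C) \<phi> \<and> dominated E f (\<Inter>C) \<psi>"
    if H: "\<phi> \<in> dual_unit_ball E" "\<psi> \<in> dual_unit_ball E" "0 < t" "t < 1"
      "dominated E f (\<Inter>C) ((1 - t) *\<^sub>R \<phi> + t *\<^sub>R \<psi>)" for \<phi> \<psi> t
  proof -
    have "dominated E f K \<phi> \<and> dominated E f K \<psi>" if "K \<in> C" for K
      using fac[OF that] H dominated_mono[OF H(5), of K] that unfolding facial_def by blast
    then show ?thesis using dom by blast
  qed
  then show ?thesis unfolding facial_def by blast
qed

text \<open>A Krein-Milman argument carried out on compact subsets of the space. On a minimal facial
  set all \<open>f h\<close> are constant, so its hull is one functional, the evaluation at
  \<open>y\<close> times the sign \<open>f(y)\<close>. Being a face, this point is extreme, and so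
  is the evaluation.\<close>

theorem norm_attained_on_choquet_boundary:
  fixes E :: "('y::t2_space \<Rightarrow>\<^sub>C real) set"
  assumes E: "subspace E" and EC: "E \<subseteq> C0" and f: "f \<in> E" "norm f = 1"
  obtains y where "y \<in> choquet_boundary E" "\<bar>apply_bcontfun f y\<bar> = 1"
proof -
  let ?p = "\<lambda>g y. apply_bcontfun f y * apply_bcontfun g y"
  define K0 where "K0 = {y. \<bar>apply_bcontfun f y\<bar> = 1}"
  define \<A> where "\<A> = {K. compact K \<and> K \<noteq> {} \<and> K \<subseteq> K0 \<and> facial E f K}"
  have "\<bar>apply_bcontfun f y\<bar> \<le> 1" for y using norm_bounded[of f y] f(2) by simp
  then have "K0 = {y. 1 \<le> \<bar>apply_bcontfun f y\<bar>}" unfolding K0_def by (auto intro: antisym)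
  then have "compact K0" using f(1) EC unfolding C0_def by auto
  moreover have "K0 \<noteq> {}" using C0_norm_attained[of f] f EC unfolding K0_def by force
  moreover have "facial E f K0" using facial_peak_set[OF E EC f] unfolding K0_def .
  ultimately have K0: "K0 \<in> \<A>" unfolding \<A>_def by blast
  have "\<exists>m\<in>\<A>. \<forall>a\<in>\<A>. a \<subseteq> m \<longrightarrow> a = m"
  proof (rule predicate_Zorn)
    \<comment> \<open>The order is reverse inclusion: upper bounds of chains are intersections, and
      a maximal element is a minimal set.\<close>
    show "partial_order_on \<A> (relation_of (\<lambda>K L. L \<subseteq> K) \<A>)"
      by (rule partial_order_on_relation_ofI) auto
    fix C assume "C \<in> Chains (relation_of (\<lambda>K L. L \<subseteq> K) \<A>)"
    then have C: "C \<subseteq> \<A>" and chain: "\<And>K L. K \<in> C \<Longrightarrow> L \<in> C \<Longrightarrow> K \<subseteq> L \<or> L \<subseteq> K"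
      unfolding Chains_def relation_of_def by blast+
    show "\<exists>u\<in>\<A>. \<forall>a\<in>C. u \<subseteq> a"
    proof (cases "C = {}")
      case True
      then show ?thesis using K0 by blast
    next
      case False
      have "\<Inter>C \<noteq> {}" using False C chain unfolding \<A>_def
        by (intro compact_chain_Inter_nonempty) auto
      moreover have "compact (\<Inter>C)"
      proof -
        obtain K where "K \<in> C" using False by blast
        moreover have "closed (\<Inter>C)"
          using C compact_imp_closed unfolding \<A>_def by (intro closed_Inter) blast
        ultimately have "compact (K \<inter> \<Inter>C)"
          using C unfolding \<A>_def by (intro compact_Int_closed) auto
        moreover have "K \<inter> \<Inter>C = \<Inter>C" using \<open>K \<in> C\<close> by blast
        ultimately show ?thesis by simp
      qed
      moreover have "facial E f (\<Inter>C)" using False C chain unfolding \<A>_def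
        by (intro facial_Inter) auto
      ultimately show ?thesis using False C unfolding \<A>_def by blast
    qed
  qed
  then obtain K where KA: "K \<in> \<A>" and min: "\<And>L. L \<in> \<A> \<Longrightarrow> L \<subseteq> K \<Longrightarrow> L = K"
    by blast
  from KA have K: "compact K" "K \<noteq> {}" "K \<subseteq> K0" "facial E f K"
    unfolding \<A>_def by auto
  obtain y where y: "y \<in> K" using K(2) by blast
  have const: "?p h z = ?p h y" if h: "h \<in> E" and z: "z \<in> K" for h z
  proof -
    define K' where "K' = {y\<in>K. \<forall>z\<in>K. ?p h z \<le> ?p h y}"
    have "K' \<in> \<A>" using facial_argmax[OF E K(1,2,4) h] K(3) unfolding K'_def \<A>_def by auto
    then have "K' = K" using min unfolding K'_def by blast
    then show ?thesis using y z unfolding K'_def by (auto intro: antisym)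
  qed
  define c where "c = apply_bcontfun f y"
  have c: "c = 1 \<or> c = -1" using y K(3) unfolding c_def K0_def by auto
  have cc: "c * c = 1" using c by auto
  have "point_eval E y extreme_point_of dual_unit_ball E"
    unfolding extreme_point_of_def
  proof (intro conjI ballI notI)
    show "point_eval E y \<in> dual_unit_ball E" by (rule point_eval_in_dual_unit_ball[OF E])
    fix \<phi> \<psi> assume \<phi>: "\<phi> \<in> dual_unit_ball E" and \<psi>: "\<psi> \<in> dual_unit_ball E"
      and "point_eval E y \<in> open_segment \<phi> \<psi>"
    then obtain t where "\<phi> \<noteq> \<psi>" and t: "0 < t" "t < 1"
      and eq: "point_eval E y = (1 - t) *\<^sub>R \<phi> + t *\<^sub>R \<psi>"
      unfolding in_segment by blast
    \<comment> \<open>Domination refers to evaluations signed by \<open>f\<close>, so the whole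
      segment is first multiplied by the sign \<open>c\<close>, which preserves the ball.\<close>
    have "c *\<^sub>R \<theta> \<in> dual_unit_ball E" if "\<theta> \<in> dual_unit_ball E" for \<theta>
      using c
    proof
      assume "c = - 1"
      then have "c *\<^sub>R \<theta> = - \<theta>" by (simp only: scaleR_minus1_left)
      then show ?thesis using dual_unit_ball_uminus[OF E that] by (simp only:)
    next
      assume "c = 1"
      then have "c *\<^sub>R \<theta> = \<theta>" by (simp only: scaleR_one)
      then show ?thesis using that by (simp only:)
    qed
    from this[OF \<phi>] this[OF \<psi>]
    have ball: "c *\<^sub>R \<phi> \<in> dual_unit_ball E" "c *\<^sub>R \<psi> \<in> dual_unit_ball E" .
    have "dominated E f K ((1 - t) *\<^sub>R c *\<^sub>R \<phi> + t *\<^sub>R c *\<^sub>R \<psi>)"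
      unfolding dominated_def
    proof
      fix g assume g: "g \<in> E"
      have "((1 - t) *\<^sub>R c *\<^sub>R \<phi> + t *\<^sub>R c *\<^sub>R \<psi>) g = c * ((1 - t) *\<^sub>R \<phi> + t *\<^sub>R \<psi>) g"
        by (simp add: scaleR_fun_def algebra_simps)
      also have "\<dots> = c * apply_bcontfun g y" unfolding eq[symmetric] point_eval_def using g by simp
      finally show "\<exists>y\<in>K. ((1 - t) *\<^sub>R c *\<^sub>R \<phi> + t *\<^sub>R c *\<^sub>R \<psi>) g \<le> ?p g y"
        using y unfolding c_def by (intro bexI[of _ y]) auto
    qed
    then have dom: "dominated E f K (c *\<^sub>R \<phi>)" "dominated E f K (c *\<^sub>R \<psi>)"
      using K(4) ball t unfolding facial_def by blast+
    \<comment> \<open>By constancy on \<open>K\<close>, domination bounds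
      \<open>c * \<theta>\<close> above by \<open>c\<close> times the evaluation; the same bound at
      \<open>- g\<close> gives equality.\<close>
    have unique: "\<theta> = point_eval E y"
      if \<theta>: "\<theta> \<in> dual_unit_ball E" and d: "dominated E f K (c *\<^sub>R \<theta>)" for \<theta>
    proof
      fix g
      show "\<theta> g = point_eval E y g"
      proof (cases "g \<in> E")
        case True
        have le: "c * \<theta> h \<le> c * apply_bcontfun h y" if "h \<in> E" for h
          using d const[OF that] that unfolding dominated_def c_def
          by (force simp: scaleR_fun_def)
        have "c * \<theta> g \<ge> c * apply_bcontfun g y"
          using le[OF subspace_neg[OF E True]] dual_unit_ballD(4)[OF E \<theta> True True] by simp
        with le[OF True] have "c * \<theta> g = c * apply_bcontfun g y" by (rule antisym)
        then have "c * (c * \<theta> g) = c * (c * apply_bcontfun g y)" by (rule arg_cong)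
        then have "\<theta> g = apply_bcontfun g y" using cc unfolding mult.assoc[symmetric] by simp
        then show ?thesis using True unfolding point_eval_def by simp
      next
        case False
        then show ?thesis using \<theta> unfolding dual_unit_ball_iff[OF E] point_eval_def by simp
      qed
    qed
    show False using unique[OF \<phi> dom(1)] unique[OF \<psi> dom(2)] \<open>\<phi> \<noteq> \<psi>\<close> by simp
  qed
  then show thesis using that y K(3) unfolding choquet_boundary_def K0_def by blast
qed

section \<open>Peaking functions\<close>

text \<open>The partial sums converge uniformly, that is in norm, and a closed subspace keeps the
  limit.\<close>

lemma weierstrass_series_in_closed_subspace:
  fixes v :: "nat \<Rightarrow> 'y::topological_space \<Rightarrow>\<^sub>C real"
  assumes E: "subspace E" "closed E" and v: "\<And>n. v n \<in> E"
    and M: "\<And>n x. \<bar>apply_bcontfun (v n) x\<bar> \<le> M n" "summable M"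
  obtains w where "w \<in> E" "\<And>x. (\<lambda>n. apply_bcontfun (v n) x) sums apply_bcontfun w x"
proof -
  let ?S = "\<lambda>m. \<Sum>n<m. v n"
  have app: "apply_bcontfun (?S m) x = (\<Sum>n<m. apply_bcontfun (v n) x)" for m x
    by (induction m) auto
  have "uniform_limit UNIV (\<lambda>m. apply_bcontfun (?S m))
      (\<lambda>x. \<Sum>n. apply_bcontfun (v n) x) sequentially"
    using Weierstrass_m_test[of UNIV "\<lambda>n. apply_bcontfun (v n)" M] M unfolding app by simp
  then obtain w where w: "(\<lambda>x. \<Sum>n. apply_bcontfun (v n) x) = apply_bcontfun w" "?S \<longlonglongrightarrow> w"
    by (rule uniform_limit_bcontfunE) auto
  have "w \<in> E"
    by (rule closed_sequentially[OF E(2) _ w(2)]) (intro subspace_sum[OF E(1)] v)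
  moreover have "(\<lambda>n. apply_bcontfun (v n) x) sums apply_bcontfun w x" for x
  proof -
    have "summable (\<lambda>n. apply_bcontfun (v n) x)"
      by (rule summable_comparison_test[OF _ M(2)]) (use M(1) in auto)
    then show ?thesis using w(1) by (metis summable_sums)
  qed
  ultimately show thesis using that by blast
qed

text \<open>Bishop's construction: \<open>v = \<Sum> 2\<^bsup>-n-1\<^esup> u\<^sub>n\<close>, where \<open>u\<^sub>n\<close> peaks at \<open>y\<close> and is at most \<open>\<delta>\<close> off
  the neighbourhood of \<open>y\<close> on which \<open>r > 1 - 2\<^bsup>-n-2\<^esup>\<close>.\<close>

lemma peak_below:
  fixes E :: "('y::topological_space \<Rightarrow>\<^sub>C real) set"
  assumes E: "subspace E" "closed E" "condition_r E" and y: "y \<in> choquet_boundary E"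
    and r: "continuous_on UNIV r" "r y = 1" "\<And>x. \<delta> \<le> r x" and "\<delta> > 0"
  obtains v where "v \<in> E" "apply_bcontfun v y = 1"
    "\<And>x. 0 \<le> apply_bcontfun v x" "\<And>x. apply_bcontfun v x \<le> 1" "\<And>x. apply_bcontfun v x \<le> r x"
proof -
  \<comment> \<open>The cap 1/2 makes \<open>d * (1/2)^Suc m\<close> at most
    \<open>(1/2)^(m+2)\<close>, the most by which \<open>r\<close> can miss 1 on
    \<open>V m\<close>.\<close>
  define d where "d = min \<delta> (1 / 2)"
  have d: "d > 0" "d \<le> 1 / 2" "\<And>x. d \<le> r x"
    using \<open>\<delta> > 0\<close> r(3) unfolding d_def by (auto simp: min_le_iff_disj)
  define V where "V n = {x. 1 - (1/2)^(n+2) < r x}" for n :: nat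
  have "\<exists>u\<in>E. (\<forall>x. 0 \<le> apply_bcontfun u x \<and> apply_bcontfun u x \<le> 1) \<and>
      apply_bcontfun u y = 1 \<and> (\<forall>x. x \<notin> V n \<longrightarrow> apply_bcontfun u x \<le> d)" for n
  proof -
    have "open (V n)" unfolding V_def using r(1) by (intro open_Collect_less continuous_intros)
    moreover have "y \<in> V n" unfolding V_def using r(2) by simp
    ultimately show ?thesis using E(3) y d(1) unfolding condition_r_def by blast
  qed
  then obtain u where u: "\<And>n. u n \<in> E" "\<And>n x. 0 \<le> apply_bcontfun (u n) x"
    "\<And>n x. apply_bcontfun (u n) x \<le> 1" "\<And>n. apply_bcontfun (u n) y = 1"
    "\<And>n x. x \<notin> V n \<Longrightarrow> apply_bcontfun (u n) x \<le> d"
    by metis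
  define q :: "nat \<Rightarrow> real" where "q n = (1/2)^(n+1)" for n :: nat
  have q: "q n > 0" for n unfolding q_def by simp
  have qs: "q sums 1"
    using sums_mult[OF geometric_sums[of "1/2 :: real"], of "1/2"] unfolding q_def by simp
  obtain v where v: "v \<in> E" "\<And>x. (\<lambda>n. apply_bcontfun (q n *\<^sub>R u n) x) sums apply_bcontfun v x"
  proof (rule weierstrass_series_in_closed_subspace[OF E(1,2), of "\<lambda>n. q n *\<^sub>R u n" q])
    show "q n *\<^sub>R u n \<in> E" for n by (rule subspace_scale[OF E(1) u(1)])
    show "\<bar>apply_bcontfun (q n *\<^sub>R u n) x\<bar> \<le> q n" for n x
      using u(2,3)[of n x] q[of n] by (simp add: abs_mult mult_left_le)
    show "summable q" using qs by (rule sums_summable)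
  qed (rule that)
  have vs: "(\<lambda>n. q n * apply_bcontfun (u n) x) sums apply_bcontfun v x" for x
    using v(2)[of x] by simp
  show thesis
  proof (rule that[OF v(1)])
    show "apply_bcontfun v y = 1" using vs[of y] qs u(4) sums_unique2 by force
    show "0 \<le> apply_bcontfun v x" for x
      by (rule sums_le[OF _ sums_zero vs]) (simp add: u(2) q less_imp_le)
    show "apply_bcontfun v x \<le> 1" for x
      by (rule sums_le[OF _ vs qs]) (simp add: u(3) q less_imp_le mult_left_le)
    show "apply_bcontfun v x \<le> r x" for x
    proof -
      have total: "(\<Sum>n<m. q n * apply_bcontfun (u n) x) \<le> 1 - (1/2)^m" for m
      proof (induction m)
        case (Suc m)
        have "q m * apply_bcontfun (u m) x \<le> q m" using u(3) q[of m] by (simp add: mult_left_le)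
        moreover have "(1/2)^Suc m + q m = (1/2)^m" unfolding q_def by simp
        ultimately show ?case using Suc unfolding sum.lessThan_Suc by linarith
      qed simp
      \<comment> \<open>The invariant leaves a margin \<open>d * (1/2)^m\<close> below
        \<open>r x\<close>. On \<open>V m\<close> it follows from the crude bound
        \<open>total\<close>, as \<open>r x\<close> misses 1 by less than half of
        \<open>(1/2)^Suc m\<close>. Off \<open>V m\<close> the new term is at most
        \<open>q m * d\<close>, exactly the decrease of the margin.\<close>
      have part: "(\<Sum>n<m. q n * apply_bcontfun (u n) x) \<le> r x - d * (1/2)^m" for m
      proof (induction m)
        case 0
        then show ?case using d(3) by simp
      next
        case (Suc m)
        show ?case
        proof (cases "x \<in> V m")
          case True
          have "d * (1/2)^Suc m \<le> 1/2 * (1/2)^Suc m" using d(2) by (intro mult_right_mono) auto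
          moreover have "1 - 1/2 * (1/2)^Suc m < r x" using True unfolding V_def by simp
          ultimately show ?thesis using total[of "Suc m"] by linarith
        next
          case False
          have "q m * apply_bcontfun (u m) x \<le> q m * d"
            using u(5)[OF False] q[of m] by simp
          moreover have "q m * d = d * (1/2)^m - d * (1/2)^Suc m" unfolding q_def by simp
          ultimately show ?thesis using Suc unfolding sum.lessThan_Suc by linarith
        qed
      qed
      have "(\<Sum>n<m. q n * apply_bcontfun (u n) x) \<le> r x" for m
      proof -
        have "0 \<le> d * (1/2)^m" using d(1) by simp
        then show ?thesis using part[of m] by linarith
      qed
      moreover have "(\<lambda>m. \<Sum>n<m. q n * apply_bcontfun (u n) x) \<longlonglongrightarrow> apply_bcontfun v x"
        using vs[of x] unfolding sums_def .
      ultimately show ?thesis by (intro LIMSEQ_le_const2) auto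
    qed
  qed
qed

lemma norm_abs_value_le_one:
  fixes f :: "'y::topological_space \<Rightarrow>\<^sub>C real"
  assumes "norm f = 1"
  shows "\<bar>apply_bcontfun f y\<bar> \<le> 1"
  using norm_bounded[of f y] assms by simp

text \<open>The estimate is sharp up to \<open>\<epsilon>\<close>, because \<open>u - f\<close> has
  value \<open>1 - f(y)\<close> at \<open>y\<close>. Shrinking \<open>f\<close> slightly leaves room
  below 1, which a multiple of a peaking function fills at \<open>y\<close> and never
  exceeds.\<close>

lemma near_peak:
  fixes E :: "('y::topological_space \<Rightarrow>\<^sub>C real) set"
  assumes E: "subspace E" "closed E" "condition_r E" and y: "y \<in> choquet_boundary E"
    and f: "f \<in> E" "norm f = 1" and "\<epsilon> > 0"
  obtains u where "u \<in> E" "norm u = 1" "apply_bcontfun u y = 1"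
    "norm (f - u) \<le> 1 - apply_bcontfun f y + \<epsilon>"
proof -
  note f1 = norm_abs_value_le_one[OF f(2)]
  \<comment> \<open>Shrinking \<open>f\<close> costs at most \<open>s\<close>, and so does the
    excess of \<open>c\<close> over \<open>1 - f(y)\<close>.\<close>
  define s where "s = min (1/2) (\<epsilon> / 2)"
  have s: "0 < s" "s \<le> 1 / 2" "2 * s \<le> \<epsilon>" using \<open>\<epsilon> > 0\<close> unfolding s_def by auto
  let ?g = "\<lambda>x. (1 - s) * apply_bcontfun f x"
  have g: "\<bar>?g x\<bar> \<le> 1 - s" for x
    using s f1[of x] by (simp add: abs_mult mult_left_le)
  define c where "c = 1 - ?g y"
  have c: "c > 0" "c \<le> 2" using g[of y] s unfolding c_def by linarith+
  \<comment> \<open>The condition \<open>v \<le> r\<close> says that \<open>(1 - s) f + c v\<close>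
    is at most 1. The factor \<open>1 - s\<close> gives \<open>r\<close> the positive lower bound
    that \<open>peak_below\<close> asks for.\<close>
  define r where "r x = (1 - ?g x) / c" for x
  obtain v where v: "v \<in> E" "apply_bcontfun v y = 1" "\<And>x. 0 \<le> apply_bcontfun v x"
    "\<And>x. apply_bcontfun v x \<le> 1" "\<And>x. apply_bcontfun v x \<le> r x"
  proof (rule peak_below[OF E y, of r "s / 2"])
    show "continuous_on UNIV r" unfolding r_def using c by (intro continuous_intros) auto
    show "r y = 1" unfolding r_def using c c_def by simp
    show "s / 2 \<le> r x" for x
    proof -
      have "s / 2 * c \<le> s" using c s by (simp add: mult_left_le)
      also have "s \<le> 1 - ?g x" using g[of x] by linarith
      finally show ?thesis unfolding r_def using c by (simp add: pos_le_divide_eq)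
    qed
    show "s / 2 > 0" using s by simp
  qed (rule that)
  define u where "u = (1 - s) *\<^sub>R f + c *\<^sub>R v"
  have ux: "apply_bcontfun u x = ?g x + c * apply_bcontfun v x" for x unfolding u_def by simp
  have uE: "u \<in> E" unfolding u_def using f v(1) by (intro subspace_add subspace_scale E)
  have uy: "apply_bcontfun u y = 1" unfolding ux v(2) c_def by simp
  have cv: "0 \<le> c * apply_bcontfun v x" "c * apply_bcontfun v x \<le> c" "c * apply_bcontfun v x \<le> 1 - ?g x" for x
    using v(3-5)[of x] c unfolding r_def by (auto simp: pos_le_divide_eq mult_left_le mult.commute)
  have "norm u \<le> 1"
  proof (rule norm_bound)
    fix x show "norm (apply_bcontfun u x) \<le> 1"
      using cv[of x] g[of x] s unfolding ux by simp
  qed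
  moreover have "norm u \<ge> 1" using norm_bounded[of u y] uy by simp
  ultimately have "norm u = 1" by simp
  moreover have "norm (f - u) \<le> 1 - apply_bcontfun f y + \<epsilon>"
  proof (rule norm_bound)
    fix x
    have "\<bar>s * apply_bcontfun f x\<bar> \<le> s" for x using s f1[of x] by (simp add: abs_mult mult_left_le)
    moreover from this[of y] have "c \<le> 1 - apply_bcontfun f y + s" unfolding c_def by (simp add: algebra_simps)
    moreover have "apply_bcontfun (f - u) x = s * apply_bcontfun f x - c * apply_bcontfun v x"
      using ux by (simp add: algebra_simps)
    ultimately show "norm (apply_bcontfun (f - u) x) \<le> 1 - apply_bcontfun f y + \<epsilon>"
      using cv[of x] s(3) unfolding real_norm_def by (smt (verit))
  qed
  ultimately show thesis using that uE uy by blast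
qed

section \<open>Isometries between unit spheres\<close>

text \<open>Equality in the triangle inequality survives nonnegative weights: with \<open>M\<close>
  the total weight, subtract the sum of the \<open>(M - t i) *\<^sub>R a i\<close> from
  \<open>M\<close> times the plain sum and use the reverse triangle inequality.\<close>

lemma norm_sum_scaled_of_additive:
  fixes a :: "'i \<Rightarrow> 'b::real_normed_vector"
  assumes I: "finite I" and unit: "\<And>i. i \<in> I \<Longrightarrow> norm (a i) = 1"
    and add: "real (card I) \<le> norm (\<Sum>i\<in>I. a i)" and t: "\<And>i. i \<in> I \<Longrightarrow> 0 \<le> t i"
  shows "norm (\<Sum>i\<in>I. t i *\<^sub>R a i) = (\<Sum>i\<in>I. t i)"
proof (rule antisym)
  have "norm (\<Sum>i\<in>I. t i *\<^sub>R a i) \<le> (\<Sum>i\<in>I. norm (t i *\<^sub>R a i))" by (rule norm_sum)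
  also have "\<dots> = (\<Sum>i\<in>I. t i)" using unit t by (intro sum.cong) auto
  finally show "norm (\<Sum>i\<in>I. t i *\<^sub>R a i) \<le> (\<Sum>i\<in>I. t i)" .
  define M where "M = (\<Sum>i\<in>I. t i)"
  have M: "t i \<le> M" if "i \<in> I" for i unfolding M_def using t that I by (intro member_le_sum) auto
  have M0: "M \<ge> 0" unfolding M_def using t by (rule sum_nonneg)
  have "(\<Sum>i\<in>I. t i *\<^sub>R a i) = M *\<^sub>R (\<Sum>i\<in>I. a i) - (\<Sum>i\<in>I. (M - t i) *\<^sub>R a i)"
    by (simp add: scaleR_sum_right scaleR_diff_left sum_subtractf)
  then have "norm (\<Sum>i\<in>I. t i *\<^sub>R a i) \<ge> norm (M *\<^sub>R (\<Sum>i\<in>I. a i)) - norm (\<Sum>i\<in>I. (M - t i) *\<^sub>R a i)"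
    using norm_triangle_ineq2 by (simp only:)
  moreover have "norm (M *\<^sub>R (\<Sum>i\<in>I. a i)) \<ge> M * card I"
    using add M0 by (simp add: mult_left_mono)
  moreover have "norm (\<Sum>i\<in>I. (M - t i) *\<^sub>R a i) \<le> (\<Sum>i\<in>I. norm ((M - t i) *\<^sub>R a i))"
    by (rule norm_sum)
  moreover have "(\<Sum>i\<in>I. norm ((M - t i) *\<^sub>R a i)) = (\<Sum>i\<in>I. M - t i)"
    using unit M by (intro sum.cong) auto
  moreover have "(\<Sum>i\<in>I. M - t i) = M * card I - (\<Sum>i\<in>I. t i)"
    by (simp add: sum_subtractf mult.commute)
  ultimately show "(\<Sum>i\<in>I. t i) \<le> norm (\<Sum>i\<in>I. t i *\<^sub>R a i)" by linarith
qed

text \<open>By induction the partial sum \<open>s\<close> has full norm, so its normalization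
  \<open>b\<close> satisfies \<open>norm (b + e) = 2\<close>. The star property passes this on to
  the next vector, and scaling back shows that adding that vector raises the norm by 1.\<close>

lemma norm_sum_of_star:
  fixes a :: "'i \<Rightarrow> 'b::real_normed_vector"
  assumes B: "subspace B" and "finite I" and e: "e \<in> B" "norm e = 1"
    and a: "\<And>i. i \<in> I \<Longrightarrow> a i \<in> B" "\<And>i. i \<in> I \<Longrightarrow> norm (a i) = 1"
    and star: "\<And>b i. b \<in> B \<Longrightarrow> norm b = 1 \<Longrightarrow> norm (b + e) = 2 \<Longrightarrow> i \<in> I \<Longrightarrow> norm (b + a i) = 2"
  shows "norm (e + (\<Sum>i\<in>I. a i)) = 1 + real (card I)"
  using \<open>finite I\<close> a star
proof (induction I rule: finite_induct)
  case empty
  then show ?case using e by simp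
next
  case (insert j I)
  define n where "n = 1 + real (card I)"
  define s where "s = e + (\<Sum>i\<in>I. a i)"
  have n: "n > 0" unfolding n_def by simp
  have s: "norm s = n" unfolding s_def n_def using insert by auto
  have sB: "s \<in> B" unfolding s_def
    using e insert.prems by (intro subspace_add[OF B] subspace_sum[OF B]) auto
  define b where "b = (1 / n) *\<^sub>R s"
  have b: "b \<in> B" "norm b = 1" unfolding b_def using sB s n by (auto intro: subspace_scale[OF B])
  have sb: "s = n *\<^sub>R b" unfolding b_def using n by simp
  have le2: "norm (b + x) \<le> 2" if "norm x = 1" for x
    using norm_triangle_ineq[of b x] b that by simp
  have "norm (b + e) = 2"
  proof (rule antisym[OF le2[OF e(2)]])
    have "norm (s - e) \<le> n - 1"
    proof -
      have "norm (\<Sum>i\<in>I. a i) \<le> (\<Sum>i\<in>I. norm (a i))" by (rule norm_sum)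
      also have "\<dots> = card I" using insert.prems(2) by simp
      finally show ?thesis unfolding s_def n_def by simp
    qed
    then have "norm (n *\<^sub>R (s - e)) \<le> n * (n - 1)" using n by simp
    \<comment> \<open>Here \<open>s\<close> has norm \<open>n\<close>, while \<open>s - e\<close> is
      a sum of \<open>n - 1\<close> unit vectors.\<close>
    moreover have "n *\<^sub>R (b + e) = (n + 1) *\<^sub>R s - n *\<^sub>R (s - e)"
      unfolding sb by (simp add: algebra_simps)
    then have "n * norm (b + e) \<ge> (n + 1) * n - norm (n *\<^sub>R (s - e))"
      using norm_triangle_ineq2[of "(n + 1) *\<^sub>R s" "n *\<^sub>R (s - e)"] s n
      by (metis abs_of_pos add_pos_pos norm_scaleR zero_less_one)
    ultimately have "n * norm (b + e) \<ge> n * 2" by (simp add: algebra_simps)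
    then show "norm (b + e) \<ge> 2" using n by simp
  qed
  then have ba: "norm (b + a j) = 2" using insert.prems(3)[OF b] by blast
  have "n *\<^sub>R (b + a j) = (s + a j) + (n - 1) *\<^sub>R a j"
    unfolding sb by (simp add: algebra_simps)
  then have "n * norm (b + a j) \<le> norm (s + a j) + norm ((n - 1) *\<^sub>R a j)"
    using norm_triangle_ineq[of "s + a j" "(n - 1) *\<^sub>R a j"] n
    by (metis abs_of_pos norm_scaleR)
  moreover have "norm ((n - 1) *\<^sub>R a j) = n - 1" using insert.prems(2)[of j] unfolding n_def by simp
  ultimately have "norm (s + a j) \<ge> n + 1" using ba by simp
  moreover have "norm (s + a j) \<le> n + 1"
    using norm_triangle_ineq[of s "a j"] s insert.prems(2)[of j] by simp
  moreover have "e + (\<Sum>i\<in>insert j I. a i) = s + a j"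
    unfolding s_def using insert.hyps by (simp add: ac_simps)
  moreover have "1 + real (card (insert j I)) = n + 1" using insert.hyps unfolding n_def by simp
  ultimately show ?case by simp
qed

text \<open>The image of a barycentre is the centre of a star: a point of the sphere at distance 2
  from the barycentre is at distance 2 from each averaged point, and \<open>T\<close> transports
  these distances.\<close>

lemma norm_convex_hull_image:
  fixes T :: "'a::real_normed_vector \<Rightarrow> 'b::real_normed_vector"
  assumes B: "subspace B" and T: "surj_isometry_on (E \<inter> sphere 0 1) (B \<inter> sphere 0 1) T"
    and C: "convex C" "C \<subseteq> E \<inter> sphere 0 1" and x: "x \<in> convex hull (T ` C)"
  shows "norm x = 1"
proof -
  have TS: "T ` (E \<inter> sphere 0 1) = B \<inter> sphere 0 1"
    and iso: "\<And>f g. f \<in> E \<inter> sphere 0 1 \<Longrightarrow> g \<in> E \<inter> sphere 0 1 \<Longrightarrow> norm (T f - T g) = norm (f - g)"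
    using T unfolding surj_isometry_on_def dist_norm by blast+
  obtain I t where I: "finite I" "I \<subseteq> T ` C" and t: "\<And>i. i \<in> I \<Longrightarrow> 0 \<le> t i" "sum t I = 1"
    and x: "x = (\<Sum>i\<in>I. t i *\<^sub>R i)"
    using x unfolding convex_hull_explicit by blast
  have "I \<noteq> {}" using t(2) by auto
  define n where "n = real (card I)"
  have n: "n > 0" using I(1) \<open>I \<noteq> {}\<close> unfolding n_def by (simp add: card_gt_0_iff)
  obtain c where c: "\<And>i. i \<in> I \<Longrightarrow> c i \<in> C" "\<And>i. i \<in> I \<Longrightarrow> T (c i) = i"
    using I(2) by (metis (no_types) image_iff subset_eq)
  have IB: "i \<in> B \<inter> sphere 0 1" if "i \<in> I" for i
    using I(2) that C(2) TS by blast
  define u where "u = (\<Sum>i\<in>I. (1 / n) *\<^sub>R c i)"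
  have u: "u \<in> C" unfolding u_def
    using C(1) I(1) c n by (intro convex_sum) (auto simp: n_def)
  then have Tu: "T u \<in> B \<inter> sphere 0 1" using C(2) TS by blast
  have star: "norm (b + i) = 2" if b: "b \<in> B" "norm b = 1" "norm (b + T u) = 2" and i: "i \<in> I" for b i
  proof -
    \<comment> \<open>The number \<open>norm (b + w)\<close> is the distance from \<open>- b\<close>
      to \<open>w\<close>, so \<open>- b\<close> is the point to pull back through
      \<open>T\<close>.\<close>
    have "- b \<in> B \<inter> sphere 0 1" using b subspace_neg[OF B] by simp
    then obtain z where z: "z \<in> E \<inter> sphere 0 1" "- b = T z" using TS by (metis imageE)
    have neg: "norm (- b - w) = norm (b + w)" for w
    proof -
      have "- b - w = - (b + w)" by simp
      then show ?thesis by (simp only: norm_minus_cancel)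
    qed
    have "norm (T z - T u) = 2" using b(3) neg[of "T u"] unfolding z(2) by simp
    then have zu: "norm (z - u) = 2" using iso z(1) u C(2) by (metis subsetD)
    have le2: "norm (z - c k) \<le> 2" if "k \<in> I" for k
      using norm_triangle_ineq4[of z "c k"] z(1) c(1)[OF that] C(2) by auto
    have "z - u = (1 / n) *\<^sub>R (\<Sum>k\<in>I. z - c k)"
      unfolding u_def using n by (simp add: sum_subtractf scaleR_sum_right scaleR_diff_right n_def sum_constant_scaleR)
    then have "norm (z - u) = (1 / n) * norm (\<Sum>k\<in>I. z - c k)" using n by simp
    then have "2 * n = norm (\<Sum>k\<in>I. z - c k)" using zu n by (simp add: field_simps)
    also have "\<dots> \<le> (\<Sum>k\<in>I. norm (z - c k))" by (rule norm_sum)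
    also have "\<dots> = norm (z - c i) + (\<Sum>k\<in>I - {i}. norm (z - c k))"
      using I(1) i by (rule sum.remove)
    also have "(\<Sum>k\<in>I - {i}. norm (z - c k)) \<le> real (card (I - {i})) * 2"
      by (rule sum_bounded_above) (use le2 in auto)
    also have "real (card (I - {i})) = n - 1" using I(1) i n unfolding n_def by (simp add: of_nat_diff)
    finally have "norm (z - c i) \<ge> 2" by simp
    then have "norm (z - c i) = 2" using le2[OF i] by simp
    moreover have "c i \<in> E \<inter> sphere 0 1" using c(1)[OF i] C(2) by blast
    ultimately have "norm (T z - i) = 2" using iso[OF z(1), of "c i"] c(2)[OF i] by simp
    then show ?thesis using neg[of i] unfolding z(2) by simp
  qed
  have "norm (T u + (\<Sum>i\<in>I. i)) = 1 + real (card I)"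
    by (rule norm_sum_of_star[OF B I(1)]) (use Tu IB star in auto)
  \<comment> \<open>Dropping the unit vector \<open>T u\<close> lowers the norm by at most
    1.\<close>
  then have "norm (\<Sum>i\<in>I. i) \<ge> real (card I)"
    using norm_triangle_ineq[of "T u" "\<Sum>i\<in>I. i"] Tu by simp
  then have "norm (\<Sum>i\<in>I. t i *\<^sub>R i) = (\<Sum>i\<in>I. t i)"
    using IB t(1) by (intro norm_sum_scaled_of_additive[OF I(1)]) auto
  then show ?thesis using x t(2) by simp
qed

text \<open>The largest sublinear functional below the norm that is \<open>-1\<close> on \<open>-K\<close>.\<close>

lemma sublinear_of_convex_in_sphere:
  fixes K :: "'b::real_normed_vector set"
  assumes K: "convex K" "K \<noteq> {}" and unit: "\<And>a. a \<in> K \<Longrightarrow> norm a = 1"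
  obtains p :: "'b \<Rightarrow> real" where "\<And>x y. p (x + y) \<le> p x + p y"
    "\<And>t x. 0 \<le> t \<Longrightarrow> p (t *\<^sub>R x) = t * p x" "\<And>x. p x \<le> norm x"
    "\<And>a. a \<in> K \<Longrightarrow> p a = 1" "\<And>a. a \<in> K \<Longrightarrow> p (- a) = - 1"
proof -
  define J where "J = {0::real..} \<times> K"
  \<comment> \<open>A sublinear \<open>p\<close> below the norm with \<open>p (- a) = - 1\<close>
    satisfies \<open>p x \<le> p (x + t *\<^sub>R a) + t * p (- a) \<le> norm (x + t *\<^sub>R a) -
    t\<close>. The infimum of these bounds is taken as \<open>p\<close>.\<close>
  define F where "F x = (\<lambda>(t, a). norm (x + t *\<^sub>R a) - t)" for x :: 'b
  define p where "p x = (INF j\<in>J. F x j)" for x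
  have "J \<noteq> {}" unfolding J_def using K(2) by auto
  have low: "- norm x \<le> F x j" if "j \<in> J" for x j
  proof -
    obtain t a where j: "j = (t, a)" "0 \<le> t" "a \<in> K" using \<open>j \<in> J\<close> unfolding J_def by auto
    have "norm (t *\<^sub>R a) = t" using j unit by simp
    then show ?thesis using norm_triangle_ineq2[of "t *\<^sub>R a" "- x"] unfolding F_def j by (simp add: add.commute)
  qed
  then have bdd: "bdd_below (F x ` J)" for x by (intro bdd_belowI2)
  have ple: "p x \<le> norm (x + t *\<^sub>R a) - t" if "0 \<le> t" "a \<in> K" for x t a
    using cINF_lower[OF bdd, of "(t, a)" x] that unfolding p_def J_def F_def by simp
  have pge: "c \<le> p x" if "\<And>t a. 0 \<le> t \<Longrightarrow> a \<in> K \<Longrightarrow> c \<le> norm (x + t *\<^sub>R a) - t" for c x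
    unfolding p_def using \<open>J \<noteq> {}\<close> by (rule cINF_greatest) (use that in \<open>auto simp: J_def F_def\<close>)
  obtain a0 where a0: "a0 \<in> K" using K(2) by blast
  have pnorm: "p x \<le> norm x" for x using ple[of 0 a0 x] a0 by simp
  have pneg: "p (- a) \<le> - 1" if "a \<in> K" for a using ple[of 1 a "- a"] that by simp
  have sub: "p (x + y) \<le> p x + p y" for x y
  proof -
    have two: "p (x + y) \<le> (norm (x + t *\<^sub>R a) - t) + (norm (y + s *\<^sub>R b) - s)"
      if ta: "0 \<le> t" "a \<in> K" "0 \<le> s" "b \<in> K" for t a s b
    proof -
      \<comment> \<open>By convexity the two shifts merge into one shift of size
        \<open>t + s\<close> along a point of \<open>K\<close>; \<open>a0\<close> serves when both
        sizes are 0.\<close>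
      obtain c where c: "c \<in> K" "(t + s) *\<^sub>R c = t *\<^sub>R a + s *\<^sub>R b"
      proof (cases "t + s = 0")
        case True
        then have "t = 0" "s = 0" using ta by auto
        then show ?thesis using that[OF a0] by simp
      next
        case False
        then have pos: "t + s > 0" using ta by simp
        have "(t / (t + s)) *\<^sub>R a + (s / (t + s)) *\<^sub>R b \<in> K"
          using ta pos by (intro convexD[OF K(1)]) (auto simp: add_divide_distrib[symmetric])
        moreover have "(t + s) *\<^sub>R ((t / (t + s)) *\<^sub>R a + (s / (t + s)) *\<^sub>R b) = t *\<^sub>R a + s *\<^sub>R b"
          using pos by (simp add: scaleR_add_right)
        ultimately show ?thesis using that by blast
      qed
      have "p (x + y) \<le> norm (x + y + (t + s) *\<^sub>R c) - (t + s)" using ple ta c(1) by simp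
      also have "x + y + (t + s) *\<^sub>R c = (x + t *\<^sub>R a) + (y + s *\<^sub>R b)" unfolding c(2) by simp
      also have "norm \<dots> - (t + s) \<le> (norm (x + t *\<^sub>R a) - t) + (norm (y + s *\<^sub>R b) - s)"
        using norm_triangle_ineq[of "x + t *\<^sub>R a" "y + s *\<^sub>R b"] by simp
      finally show ?thesis .
    qed
    have "p (x + y) - (norm (x + t *\<^sub>R a) - t) \<le> p y" if "0 \<le> t" "a \<in> K" for t a
      by (rule pge) (use two[OF that] in \<open>simp add: algebra_simps\<close>)
    then have "p (x + y) - p y \<le> p x"
      by (intro pge) (simp add: algebra_simps)
    then show ?thesis by simp
  qed
  have hom_le: "p (t *\<^sub>R x) \<le> t * p x" if t: "0 < t" for t x
  proof -
    have "p (t *\<^sub>R x) / t \<le> p x"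
    proof (rule pge)
      fix s :: real and a assume "0 \<le> s" "a \<in> K"
      then have "p (t *\<^sub>R x) \<le> norm (t *\<^sub>R x + (t * s) *\<^sub>R a) - t * s" using t by (intro ple) auto
      also have "t *\<^sub>R x + (t * s) *\<^sub>R a = t *\<^sub>R (x + s *\<^sub>R a)" by (simp add: scaleR_add_right)
      also have "norm \<dots> - t * s = t * (norm (x + s *\<^sub>R a) - s)"
        using t by (simp only: norm_scaleR abs_of_pos right_diff_distrib)
      finally show "p (t *\<^sub>R x) / t \<le> norm (x + s *\<^sub>R a) - s"
        using t by (simp add: pos_divide_le_eq mult.commute)
    qed
    then show ?thesis using t by (simp add: pos_divide_le_eq mult.commute)
  qed
  have p0: "p 0 = 0"
  proof (rule antisym)
    show "p 0 \<le> 0" using pnorm[of 0] by simp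
    show "0 \<le> p 0" by (rule pge) (simp add: unit)
  qed
  show thesis
  proof (rule that[of p])
    show "p (t *\<^sub>R x) = t * p x" if "0 \<le> t" for t x
    proof (cases "t = 0")
      case True
      then show ?thesis using p0 by simp
    next
      case False
      then have t: "t > 0" using that by simp
      \<comment> \<open>The reverse inequality is \<open>hom_le\<close> with factor
        \<open>1 / t\<close> at \<open>t *\<^sub>R x\<close>.\<close>
      have "p ((1 / t) *\<^sub>R (t *\<^sub>R x)) \<le> (1 / t) * p (t *\<^sub>R x)" using t by (intro hom_le) simp
      then have "t * p x \<le> p (t *\<^sub>R x)" using t by (simp add: field_simps)
      then show ?thesis using hom_le[OF t, of x] by simp
    qed
    fix a assume a: "a \<in> K"
    have "0 \<le> p a + p (- a)" using sub[of a "- a"] p0 by simp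
    then show "p a = 1" "p (- a) = - 1"
      using pneg[OF a] pnorm[of a] unit[OF a] by auto
  qed (use sub pnorm in auto)
qed

section \<open>The functional attached to a Choquet boundary point\<close>

text \<open>The value \<open>f(y)\<close> is read off from distances to the two opposite faces \<open>{u. u(y) = \<plusminus>1}\<close> of the
  sphere, so that any 1-Lipschitz \<open>p\<close> equal to \<open>\<plusminus>1\<close> on their images satisfies \<open>p(T f) = f(y)\<close>.\<close>

lemma lipschitz_value_at_peak_point:
  fixes E :: "('y::topological_space \<Rightarrow>\<^sub>C real) set" and T :: "('y \<Rightarrow>\<^sub>C real) \<Rightarrow> 'b::real_normed_vector"
  assumes E: "subspace E" "closed E" "condition_r E" and y: "y \<in> choquet_boundary E"
    and iso: "\<And>f g. f \<in> E \<inter> sphere 0 1 \<Longrightarrow> g \<in> E \<inter> sphere 0 1 \<Longrightarrow> norm (T f - T g) = norm (f - g)"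
    and lip: "\<And>a b. p a \<le> p b + norm (a - b)"
    and pos: "\<And>u. u \<in> E \<inter> sphere 0 1 \<Longrightarrow> apply_bcontfun u y = 1 \<Longrightarrow> p (T u) = 1"
    and neg: "\<And>u. u \<in> E \<inter> sphere 0 1 \<Longrightarrow> apply_bcontfun u y = - 1 \<Longrightarrow> p (T u) = - 1"
    and f: "f \<in> E \<inter> sphere 0 1"
  shows "p (T f) = apply_bcontfun f y"
proof (rule antisym)
  have ff: "f \<in> E" "norm f = 1" "- f \<in> E" "norm (- f) = 1" using f subspace_neg[OF E(1)] by auto
  show "apply_bcontfun f y \<le> p (T f)"
  proof (rule field_le_epsilon)
    fix \<epsilon> :: real assume "\<epsilon> > 0"
    then obtain u where u: "u \<in> E" "norm u = 1" "apply_bcontfun u y = 1"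
      "norm (f - u) \<le> 1 - apply_bcontfun f y + \<epsilon>"
      using near_peak[OF E y ff(1,2)] by blast
    then have "u \<in> E \<inter> sphere 0 1" by simp
    then have "1 \<le> p (T f) + norm (f - u)"
      using pos[OF _ u(3)] lip[of "T u" "T f"] iso[of u f] f by (simp add: norm_minus_commute)
    then show "apply_bcontfun f y \<le> p (T f) + \<epsilon>" using u(4) by simp
  qed
  \<comment> \<open>The upper bound uses a function \<open>u\<close> near \<open>- f\<close> that
    peaks at \<open>y\<close>; then \<open>- u\<close> is near \<open>f\<close> and lies in the
    opposite face.\<close>
  show "p (T f) \<le> apply_bcontfun f y"
  proof (rule field_le_epsilon)
    fix \<epsilon> :: real assume "\<epsilon> > 0"
    then obtain u where u: "u \<in> E" "norm u = 1" "apply_bcontfun u y = 1"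
      "norm (- f - u) \<le> 1 - apply_bcontfun (- f) y + \<epsilon>"
      using near_peak[OF E y ff(3,4)] by blast
    have w: "- u \<in> E \<inter> sphere 0 1" using u subspace_neg[OF E(1)] by simp
    have "norm (f - - u) = norm (- f - u)"
    proof -
      have "f - - u = - (- f - u)" by simp
      then show ?thesis by (simp only: norm_minus_cancel)
    qed
    moreover have "p (T f) \<le> - 1 + norm (f - - u)"
      using neg[OF w] u(3) lip[of "T f" "T (- u)"] iso[OF f w] by simp
    ultimately show "p (T f) \<le> apply_bcontfun f y + \<epsilon>" using u(4) by simp
  qed
qed

text \<open>The value \<open>c\<close> at \<open>y\<close> keeps the norm of a convex combination
  from dropping below 1.\<close>

lemma convex_peak_face:
  fixes E :: "('y::topological_space \<Rightarrow>\<^sub>C real) set"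
  assumes E: "subspace E" and c: "\<bar>c\<bar> = 1"
  shows "convex {f \<in> E \<inter> sphere 0 1. apply_bcontfun f y = c}"
proof (rule convexI)
  fix f g :: "'y \<Rightarrow>\<^sub>C real" and s t :: real
  assume f: "f \<in> {f \<in> E \<inter> sphere 0 1. apply_bcontfun f y = c}"
    and g: "g \<in> {f \<in> E \<inter> sphere 0 1. apply_bcontfun f y = c}"
    and st: "0 \<le> s" "0 \<le> t" "s + t = 1"
  let ?h = "s *\<^sub>R f + t *\<^sub>R g"
  have "norm ?h \<le> s + t"
    using norm_triangle_ineq[of "s *\<^sub>R f" "t *\<^sub>R g"] f g st by simp
  moreover have hy: "apply_bcontfun ?h y = c"
    using f g st(3) by (simp add: distrib_right[symmetric])
  then have "norm ?h \<ge> 1" using norm_bounded[of ?h y] c by simp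
  moreover have "?h \<in> E" using f g by (intro subspace_add[OF E] subspace_scale[OF E]) auto
  ultimately show "?h \<in> {f \<in> E \<inter> sphere 0 1. apply_bcontfun f y = c}" using hy st(3) by simp
qed

text \<open>Both \<open>p\<close> and its reflection \<open>- p (- b)\<close> are 1-Lipschitz with
  the right values on the two faces, so both take the value \<open>f(y)\<close> at
  \<open>T f\<close>. Hence \<open>p\<close> is odd on \<open>B\<close>, and an odd sublinear
  functional is linear.\<close>

lemma linear_functional_at_peak_point:
  fixes E :: "('y::topological_space \<Rightarrow>\<^sub>C real) set" and B :: "'b::real_normed_vector set"
  assumes E: "subspace E" "closed E" "condition_r E" and y: "y \<in> choquet_boundary E"
    and B: "subspace B" and T: "surj_isometry_on (E \<inter> sphere 0 1) (B \<inter> sphere 0 1) T"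
    and f0: "f\<^sub>0 \<in> E \<inter> sphere 0 1"
  obtains p :: "'b \<Rightarrow> real" where "linear_on B p"
    "\<And>f. f \<in> E \<inter> sphere 0 1 \<Longrightarrow> p (T f) = apply_bcontfun f y"
proof -
  let ?S = "E \<inter> sphere 0 1"
  have TS: "T ` ?S = B \<inter> sphere 0 1"
    and iso: "\<And>f g. f \<in> ?S \<Longrightarrow> g \<in> ?S \<Longrightarrow> norm (T f - T g) = norm (f - g)"
    using T unfolding surj_isometry_on_def dist_norm by blast+
  define P where "P = {f \<in> ?S. apply_bcontfun f y = 1}"
  define N where "N = {f \<in> ?S. apply_bcontfun f y = - 1}"
  define K where "K = convex hull (T ` P)"
  have sub: "P \<subseteq> ?S" "N \<subseteq> ?S" unfolding P_def N_def by auto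
  have "convex P" unfolding P_def by (rule convex_peak_face[OF E(1)]) simp
  moreover have "convex N" unfolding N_def by (rule convex_peak_face[OF E(1)]) simp
  ultimately have unit: "\<And>a. a \<in> K \<Longrightarrow> norm a = 1"
    and unitN: "\<And>a. a \<in> convex hull (T ` N) \<Longrightarrow> norm a = 1"
    using norm_convex_hull_image[OF B T] sub unfolding K_def by blast+
  \<comment> \<open>The midpoint of two images from \<open>N\<close> has norm 1, so the preimage
    \<open>z\<close> of \<open>- T w\<close> is at distance 2 from all of \<open>N\<close>.\<close>
  have neg: "- T w \<in> T ` P" if w: "w \<in> N" for w
  proof -
    have "T w \<in> B \<inter> sphere 0 1" using w sub(2) TS by blast
    then have "- T w \<in> B \<inter> sphere 0 1" using subspace_neg[OF B] by simp
    then obtain z where z: "z \<in> ?S" "- T w = T z" using TS by (metis imageE)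
    have far: "norm (z - x) = 2" if x: "x \<in> N" for x
    proof -
      have "(1 / 2) *\<^sub>R T w + (1 / 2) *\<^sub>R T x \<in> convex hull (T ` N)"
        using w x by (intro convexD[OF convex_convex_hull] hull_inc) auto
      then have "norm ((1 / 2) *\<^sub>R (T w + T x)) = 1" using unitN by (simp add: scaleR_add_right)
      then have "norm (T w + T x) = 2" by simp
      moreover have "T z - T x = - (T w + T x)" unfolding z(2)[symmetric] by simp
      ultimately have "norm (T z - T x) = 2" by (simp only: norm_minus_cancel)
      then show ?thesis using iso[OF z(1)] sub(2) x by (metis subsetD)
    qed
    \<comment> \<open>If \<open>z(y) < 1\<close>, a peaking function near \<open>- z\<close> yields
      a point of \<open>N\<close> at distance at most \<open>(3 + z(y)) / 2\<close>, below
      2.\<close>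
    have "apply_bcontfun z y = 1"
    proof (rule ccontr)
      assume "apply_bcontfun z y \<noteq> 1"
      moreover have "\<bar>apply_bcontfun z y\<bar> \<le> 1" using norm_abs_value_le_one[of z y] z(1) by simp
      ultimately have lt: "apply_bcontfun z y < 1" by simp
      have "- z \<in> E" "norm (- z) = 1" using z(1) subspace_neg[OF E(1)] by auto
      then obtain u where u: "u \<in> E" "norm u = 1" "apply_bcontfun u y = 1"
        "norm (- z - u) \<le> 1 - apply_bcontfun (- z) y + (1 - apply_bcontfun z y) / 2"
        using near_peak[OF E y] lt by (metis diff_gt_0_iff_gt half_gt_zero)
      have "- u \<in> N" using u subspace_neg[OF E(1)] unfolding N_def by simp
      from far[OF this] have "norm (- (- z - u)) = 2" by (simp add: add.commute)
      then have "norm (- z - u) = 2" by (simp only: norm_minus_cancel)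
      then show False using u(4) lt by (simp add: field_simps)
    qed
    then show ?thesis using z unfolding P_def by auto
  qed
  have TPK: "T u \<in> K" if "u \<in> P" for u using that unfolding K_def by (intro hull_inc) auto
  have "f\<^sub>0 \<in> E" "norm f\<^sub>0 = 1" using f0 by auto
  \<comment> \<open>The given unit vector serves to produce some point of \<open>P\<close>, so that
    \<open>K\<close> is nonempty.\<close>
  then obtain u where "u \<in> E" "norm u = 1" "apply_bcontfun u y = 1"
    using near_peak[OF E y _ _ zero_less_one] by blast
  then have "u \<in> P" unfolding P_def by simp
  then have "K \<noteq> {}" using TPK by blast
  moreover have "convex K" unfolding K_def by (rule convex_convex_hull)
  ultimately obtain p :: "'b \<Rightarrow> real" where p: "\<And>x y. p (x + y) \<le> p x + p y"
    "\<And>t x. 0 \<le> t \<Longrightarrow> p (t *\<^sub>R x) = t * p x" "\<And>x. p x \<le> norm x"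
    "\<And>a. a \<in> K \<Longrightarrow> p a = 1" "\<And>a. a \<in> K \<Longrightarrow> p (- a) = - 1"
    using sublinear_of_convex_in_sphere[of K] unit by blast
  have lip: "p a \<le> p b + norm (a - b)" for a b
    using p(1)[of "a - b" b] p(3)[of "a - b"] by simp
  have pos_val: "p (T u) = 1" "p (- T u) = - 1" if "u \<in> ?S" "apply_bcontfun u y = 1" for u
    using that p(4,5) TPK unfolding P_def by auto
  have neg_val: "p (T u) = - 1" "p (- T u) = 1" if "u \<in> ?S" "apply_bcontfun u y = - 1" for u
  proof -
    have "u \<in> N" using that unfolding N_def by simp
    then have "- T u \<in> K" using neg[of u] TPK by (metis imageE)
    from p(4)[OF this] p(5)[OF this] show "p (T u) = - 1" "p (- T u) = 1" by simp_all
  qed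
  have val: "p (T f) = apply_bcontfun f y" if "f \<in> ?S" for f
    by (rule lipschitz_value_at_peak_point[OF E y iso lip pos_val(1) neg_val(1) that])
  have val': "- p (- T f) = apply_bcontfun f y" if "f \<in> ?S" for f
  proof (rule lipschitz_value_at_peak_point[where p = "\<lambda>b. - p (- b)", OF E y iso _ _ _ that])
    show "- p (- a) \<le> - p (- b) + norm (a - b)" for a b
      using lip[of "- b" "- a"] by (simp add: norm_minus_commute)
  qed (simp_all add: pos_val(2) neg_val(2))
  have p0: "p 0 = 0" using p(2)[of 0 0] by simp
  have odd: "p (- b) = - p b" if b: "b \<in> B" for b
  proof (cases "b = 0")
    case False
    define n where "n = norm b"
    have n: "n > 0" using False unfolding n_def by simp
    have "(1 / n) *\<^sub>R b \<in> B \<inter> sphere 0 1" using b subspace_scale[OF B] False unfolding n_def by simp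
    then obtain f where f: "f \<in> ?S" "(1 / n) *\<^sub>R b = T f" using TS by (metis imageE)
    have b: "b = n *\<^sub>R T f" using n by (simp add: f(2)[symmetric])
    have "p (- b) = n * p (- T f)" using p(2)[of n "- T f"] n unfolding b by simp
    moreover have "p b = n * p (T f)" using p(2)[of n "T f"] n unfolding b by simp
    ultimately show ?thesis using val[OF f(1)] val'[OF f(1)] by (metis minus_mult_right minus_minus)
  qed (simp add: p0)
  have "linear_on B p"
    unfolding linear_on_def
  proof (intro conjI ballI allI)
    fix a b assume a: "a \<in> B" and b: "b \<in> B"
    have ab: "a + b \<in> B" using a b by (rule subspace_add[OF B])
    have "- p (a + b) \<le> - p a + - p b"
      using p(1)[of "- a" "- b"] odd[OF a] odd[OF b] odd[OF ab] by simp
    then show "p (a + b) = p a + p b" using p(1)[of a b] by simp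
  next
    fix c :: real and b assume b: "b \<in> B"
    show "p (c *\<^sub>R b) = c *\<^sub>R p b"
    proof (cases "0 \<le> c")
      case False
      have "p (c *\<^sub>R b) = p ((- c) *\<^sub>R (- b))" by simp
      also have "\<dots> = (- c) * p (- b)" using False by (intro p(2)) simp
      finally show ?thesis using odd[OF b] by simp
    qed (simp add: p(2))
  qed
  then show thesis using that val by blast
qed

section \<open>The Mazur--Ulam property\<close>

text \<open>The extension \<open>L\<close> is radial. Additivity and homogeneity are checked after
  applying the functionals of the boundary points, under which \<open>L f\<close> becomes
  \<open>f(y)\<close>; these separate the points of \<open>B\<close>.\<close>

theorem mazur_ulam_of_condition_r:
  fixes E :: "('y::t2_space \<Rightarrow>\<^sub>C real) set"
  assumes EC: "E \<subseteq> C0" and E: "subspace E" "closed E" "condition_r E"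
  shows "mazur_ulam_property TYPE('b::real_normed_vector) E"
  unfolding mazur_ulam_property_def
proof (intro allI impI, elim conjE)
  fix B :: "'b set" and T
  assume B: "subspace B" and T: "surj_isometry_on (E \<inter> sphere 0 1) (B \<inter> sphere 0 1) T"
  let ?S = "E \<inter> sphere 0 1"
  have TS: "T ` ?S = B \<inter> sphere 0 1" using T unfolding surj_isometry_on_def by blast
  \<comment> \<open>At \<open>f = 0\<close> the outer factor is 0, so \<open>L 0 = 0\<close>
    whatever the value of \<open>T\<close> at 0.\<close>
  define L where "L f = norm f *\<^sub>R T ((1 / norm f) *\<^sub>R f)" for f
  have normalized: "(1 / norm f) *\<^sub>R f \<in> ?S" if "f \<in> E" "f \<noteq> 0" for f
    using that subspace_scale[OF E(1)] by simp
  have LB: "L f \<in> B" and Ln: "norm (L f) = norm f" if "f \<in> E" for f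
  proof -
    have "L f \<in> B \<and> norm (L f) = norm f"
    proof (cases "f = 0")
      case True
      then show ?thesis unfolding L_def using subspace_0[OF B] by simp
    next
      case False
      then have "T ((1 / norm f) *\<^sub>R f) \<in> B \<inter> sphere 0 1" using normalized that TS by blast
      then show ?thesis unfolding L_def using subspace_scale[OF B] by simp
    qed
    then show "L f \<in> B" "norm (L f) = norm f" by blast+
  qed
  have surj: "\<exists>f\<in>E. L f = b" if b: "b \<in> B" for b
  proof (cases "b = 0")
    case True
    then show ?thesis using subspace_0[OF E(1)] unfolding L_def by (intro bexI[of _ 0]) auto
  next
    case False
    then have "(1 / norm b) *\<^sub>R b \<in> B \<inter> sphere 0 1" using b subspace_scale[OF B] by simp
    then obtain g where g: "g \<in> ?S" "(1 / norm b) *\<^sub>R b = T g" using TS by (metis imageE)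
    have "L (norm b *\<^sub>R g) = b"
      unfolding L_def using g False by (simp add: g(2)[symmetric])
    then show ?thesis using g(1) subspace_scale[OF E(1)] by blast
  qed
  \<comment> \<open>Write \<open>b = L f\<close>. At a boundary point where the normalized
    \<open>f\<close> has modulus 1, the corresponding functional does not vanish at \<open>b\<close>
    unless \<open>f = 0\<close>.\<close>
  have zero: "b = 0" if b: "b \<in> B"
    and p: "\<And>y p. y \<in> choquet_boundary E \<Longrightarrow> linear_on B p \<Longrightarrow>
      (\<And>f. f \<in> E \<Longrightarrow> p (L f) = apply_bcontfun f y) \<Longrightarrow> p b = 0" for b
  proof (rule ccontr)
    assume "b \<noteq> 0"
    obtain f where f: "f \<in> E" "L f = b" using surj[OF b] by blast
    then have "f \<noteq> 0" using \<open>b \<noteq> 0\<close> Ln by force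
    then have S: "(1 / norm f) *\<^sub>R f \<in> ?S" using normalized f by blast
    then obtain y where y: "y \<in> choquet_boundary E" "\<bar>apply_bcontfun ((1 / norm f) *\<^sub>R f) y\<bar> = 1"
      using norm_attained_on_choquet_boundary[OF E(1) EC] by (metis IntE mem_sphere_0)
    obtain p where lin: "linear_on B p" and val: "\<And>f. f \<in> ?S \<Longrightarrow> p (T f) = apply_bcontfun f y"
      using linear_functional_at_peak_point[OF E y(1) B T S] by blast
    have pL: "p (L g) = apply_bcontfun g y" if "g \<in> E" for g
    proof (cases "g = 0")
      case True
      have "p (0 *\<^sub>R 0) = 0 *\<^sub>R p 0" using lin subspace_0[OF B] unfolding linear_on_def by blast
      then show ?thesis using True unfolding L_def by simp
    next
      case False
      have "T ((1 / norm g) *\<^sub>R g) \<in> B" using normalized[OF that False] TS by blast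
      then have "p (L g) = norm g * p (T ((1 / norm g) *\<^sub>R g))"
        using lin unfolding linear_on_def L_def by simp
      also have "\<dots> = apply_bcontfun g y"
        using val[OF normalized[OF that False]] False by simp
      finally show ?thesis .
    qed
    have "apply_bcontfun f y = 0" using p[OF y(1) lin pL] pL[OF f(1)] f(2) by simp
    then show False using y(2) by simp
  qed
  have additive: "L (f + g) = L f + L g" if f: "f \<in> E" and g: "g \<in> E" for f g
  proof -
    have fg: "f + g \<in> E" using f g by (rule subspace_add[OF E(1)])
    have "L f + L g + (- 1) *\<^sub>R L (f + g) = 0"
    proof (rule zero)
      show "L f + L g + (- 1) *\<^sub>R L (f + g) \<in> B"
        using LB f g fg by (intro subspace_add[OF B] subspace_scale[OF B])
      fix y p assume lin: "linear_on B p" and val: "\<And>f. f \<in> E \<Longrightarrow> p (L f) = apply_bcontfun f y"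
      have "p (L f + L g + (- 1) *\<^sub>R L (f + g)) = p (L f) + p (L g) + (- 1) *\<^sub>R p (L (f + g))"
        using lin LB f g fg subspace_add[OF B] subspace_scale[OF B] unfolding linear_on_def by metis
      then show "p (L f + L g + (- 1) *\<^sub>R L (f + g)) = 0" using val f g fg by simp
    qed
    then show ?thesis by simp
  qed
  have homogeneous: "L (c *\<^sub>R f) = c *\<^sub>R L f" if f: "f \<in> E" for c f
  proof -
    have cf: "c *\<^sub>R f \<in> E" using f by (rule subspace_scale[OF E(1)])
    have "c *\<^sub>R L f + (- 1) *\<^sub>R L (c *\<^sub>R f) = 0"
    proof (rule zero)
      show "c *\<^sub>R L f + (- 1) *\<^sub>R L (c *\<^sub>R f) \<in> B"
        using LB f cf by (intro subspace_add[OF B] subspace_scale[OF B])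
      fix y p assume lin: "linear_on B p" and val: "\<And>f. f \<in> E \<Longrightarrow> p (L f) = apply_bcontfun f y"
      have "p (c *\<^sub>R L f + (- 1) *\<^sub>R L (c *\<^sub>R f)) = c *\<^sub>R p (L f) + (- 1) *\<^sub>R p (L (c *\<^sub>R f))"
        using lin LB f cf subspace_scale[OF B] unfolding linear_on_def by metis
      then show "p (c *\<^sub>R L f + (- 1) *\<^sub>R L (c *\<^sub>R f)) = 0" using val f cf by simp
    qed
    then show ?thesis by simp
  qed
  have "dist (L f) (L g) = dist f g" if f: "f \<in> E" and g: "g \<in> E" for f g
  proof -
    have mg: "(- 1) *\<^sub>R g \<in> E" using g by (rule subspace_scale[OF E(1)])
    have "L (f + (- 1) *\<^sub>R g) = L f - L g"
      using additive[OF f mg] homogeneous[OF g, of "- 1"] by simp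
    then show ?thesis using Ln[OF subspace_add[OF E(1) f mg]] by (simp add: dist_norm)
  qed
  moreover have "L ` E = B" using surj LB by blast
  ultimately have "surj_isometry_on E B L" unfolding surj_isometry_on_def by blast
  moreover have "linear_on E L" unfolding linear_on_def using additive homogeneous by blast
  moreover have "L f = T f" if "f \<in> ?S" for f using that unfolding L_def by simp
  ultimately show "\<exists>L. linear_on E L \<and> surj_isometry_on E B L \<and> (\<forall>x\<in>?S. L x = T x)" by blast
qed

section \<open>Condition (r) for all functions vanishing at infinity\<close>

text \<open>A locally compact Hausdorff space is completely regular, which yields a bump at
  \<open>y\<close> vanishing off an open \<open>U\<close> inside a compact \<open>K\<close>; the
  compact \<open>K\<close> puts it into \<open>C0\<close>.\<close>

lemma condition_r_C0:
  assumes lc: "locally compact (UNIV :: 'y::t2_space set)"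
  shows "condition_r (C0 :: ('y \<Rightarrow>\<^sub>C real) set)"
  unfolding condition_r_def
proof (intro ballI allI impI, elim conjE)
  have nbhd: "\<exists>U K. open U \<and> x \<in> U \<and> U \<subseteq> K \<and> compact K \<and> K \<subseteq> V" if V: "open V" "x \<in> V" for x :: 'y and V
  proof -
    have "openin (top_of_set UNIV) V" using V(1) by simp
    then obtain U K where "openin (top_of_set UNIV) U" "compact K" "x \<in> U" "U \<subseteq> K" "K \<subseteq> V"
      using locallyE[OF lc _ V(2)] by metis
    then show ?thesis by (intro exI[of _ U] exI[of _ K]) simp
  qed
  fix y :: 'y and V and \<epsilon> :: real
  assume V: "open V" "y \<in> V" and "\<epsilon> > 0"
  obtain U K where U: "open U" "y \<in> U" "U \<subseteq> K" "compact K" "K \<subseteq> V"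
    using nbhd[OF V] by blast
  \<comment> \<open>Complete regularity is a property of abstract topologies, so the two type-level
    assumptions are first restated for \<open>?X\<close>.\<close>
  let ?X = "euclidean :: 'y topology"
  have haus: "Hausdorff_space ?X"
    unfolding Hausdorff_space_def
  proof (intro allI impI, elim conjE)
    fix a b :: 'y assume "a \<noteq> b"
    from hausdorff[OF this] show "\<exists>U V. openin ?X U \<and> openin ?X V \<and> a \<in> U \<and> b \<in> V \<and> disjnt U V"
      by (simp add: disjnt_def)
  qed
  have lcs: "locally_compact_space ?X"
    unfolding locally_compact_space_def
  proof
    fix x :: 'y
    show "\<exists>W C. openin ?X W \<and> compactin ?X C \<and> x \<in> W \<and> W \<subseteq> C"
      using nbhd[of UNIV x] by auto
  qed
  have "completely_regular_space ?X"
    using locally_compact_regular_imp_completely_regular_space[OF lcs] haus by blast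
  moreover have "closedin ?X (- U)" using U(1) by (simp add: closed_Compl)
  moreover have "y \<in> topspace ?X - (- U)" using U(2) by simp
  ultimately have "\<exists>h. continuous_map ?X (top_of_set {0..1::real}) h \<and> h y = 0 \<and> h ` (- U) \<subseteq> {1}"
    unfolding completely_regular_space_def by blast
  then obtain h where h: "continuous_map ?X (top_of_set {0..1::real}) h" "h y = 0" "h ` (- U) \<subseteq> {1}"
    by blast
  have hc: "continuous_on UNIV h" and h01: "\<And>x. 0 \<le> h x \<and> h x \<le> 1"
    using h(1) unfolding continuous_map_in_subtopology by auto
  have "(\<lambda>x. 1 - h x) \<in> bcontfun"
    by (rule bcontfun_normI[where b = 1]) (use h01 hc in \<open>auto intro!: continuous_intros\<close>)
  then obtain u where u: "(\<lambda>x. 1 - h x) = apply_bcontfun u" by (rule bcontfunE)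
  have ux: "apply_bcontfun u x = 1 - h x" for x using u by metis
  have off: "apply_bcontfun u x = 0" if "x \<notin> U" for x using that h(3) unfolding ux by auto
  have "u \<in> C0"
  proof (rule C0_I)
    fix e :: real assume "e > 0"
    then show "\<exists>K. compact K \<and> (\<forall>y. y \<notin> K \<longrightarrow> \<bar>apply_bcontfun u y\<bar> < e)"
      using U(3,4) off by (intro exI[of _ K]) force
  qed
  moreover have "\<forall>x. x \<notin> V \<longrightarrow> apply_bcontfun u x \<le> \<epsilon>"
    using off U(3,5) \<open>\<epsilon> > 0\<close> by force
  ultimately show "\<exists>u\<in>C0. (\<forall>x. 0 \<le> apply_bcontfun u x \<and> apply_bcontfun u x \<le> 1) \<and>
      apply_bcontfun u y = 1 \<and> (\<forall>x. x \<notin> V \<longrightarrow> apply_bcontfun u x \<le> \<epsilon>)"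
    using ux h01 h(2) by (intro bexI[of _ u]) auto
qed

theorem corollary5p4:
  assumes "locally compact (UNIV :: 'y::t2_space set)"
  shows "(\<forall>E :: ('y \<Rightarrow>\<^sub>C real) set.
            E \<subseteq> C0 \<and> subspace E \<and> closed E \<and> separates_points E \<and> condition_r E \<longrightarrow>
            mazur_ulam_property TYPE('b::real_normed_vector) E) \<and>
         mazur_ulam_property TYPE('b) (C0 :: ('y \<Rightarrow>\<^sub>C real) set)"
  using mazur_ulam_of_condition_r[OF order_refl subspace_C0 closed_C0 condition_r_C0[OF assms]]
    mazur_ulam_of_condition_r by blast

end
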